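(* (1) For every MV-algebra $\mathbf{A}$, $\mathsf{V}(D(\mathbf{A}))=\mathsf{V}(\mathbf{A})_{SMMV}$. (2) For all MV-algebras $\mathbf{A}$ and $\mathbf{B}$: $\mathsf{V}(D(\mathbf{A}))=\mathsf{V}(D(\mathbf{B}))$ if and only if $\mathsf{V}(\mathbf{A})=\mathsf{V}(\mathbf{B})$. (3) The variety of all SMMV-algebras is generated by $D([0,1]_{MV})$, as well as by any $D(\mathbf{A})$ such that the MV-algebra $\mathbf{A}$ generates the variety of all MV-algebras. (4) Let $\mathbf{C}_1$ be Chang's algebra and let $\mathcal{C}$ be the variety of MV-algebras generated by it. Then $\mathcal{C}_{SMMV}$ is generated by $D(\mathbf{C}_1)$.
   Context: An MV-algebra is $\mathbf{A}=(A,\oplus,\neg,0)$ with $(A,\oplus,0)$ a commutative monoid, $\neg\neg x=x$, $x\oplus 1=1$ where $1=\neg 0$, and $(x\to y)\to y=(y\to x)\to x$ where $x\to y=\neg x\oplus y$. An SMMV-algebra is a pair $(\mathbf{A},\tau)$ where $\mathbf{A}$ is an MV-algebra and $\tau$ is an idempotent endomorphism of $\mathbf{A}$, viewed as an algebra in the signature $(\oplus,\neg,0,\tau)$; its MV-reduct is $\mathbf{A}$. For an MV-algebra $\mathbf{A}$, $D(\mathbf{A})=(\mathbf{A}\times\mathbf{A},\tau_A)$ with $\tau_A(a,b)=(a,a)$. For an algebra (or class of algebras) $K$, $\mathsf{V}(K)$ is the variety generated by $K$ (in its own signature). For a variety $\mathcal{V}$ of MV-algebras, $\mathcal{V}_{SMMV}$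 is the class of SMMV-algebras whose MV-reduct is in $\mathcal{V}$. $[0,1]_{MV}$ is the MV-algebra on the real interval $[0,1]$ with $r\oplus s=\min\{r+s,1\}$, $\neg r=1-r$. Chang's algebra $\mathbf{C}_1$ is the MV-algebra with universe $\{x\in\mathbb{Z}\times_{\mathrm{lex}}\mathbb{Z}:(0,0)\le x\le u\}$, $u=(1,0)$ (lexicographic order), with $x\oplus y=\min(x+y,u)$, $\neg x=u-x$ and zero $(0,0)$. *)

theory Defs
  imports Complex_Main "HOL-Library.FuncSet" "HOL-Library.Product_Plus"
begin

section \<open>Algebras, identities and generated varieties\<close>

text \<open>A signature is a type of operation symbols \<open>'f\<close> with an arity function \<open>ar\<close>.
  An operation is applied to the list of its arguments; its value on lists of the wrong length or
  with entries outside the universe is irrelevant.\<close>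

record ('f, 'a) alg =
  universe :: "'a set"
  interp :: "'f \<Rightarrow> 'a list \<Rightarrow> 'a"

definition wf_alg :: "('f \<Rightarrow> nat) \<Rightarrow> ('f, 'a) alg \<Rightarrow> bool" where
  "wf_alg ar A \<longleftrightarrow> universe A \<noteq> {} \<and>
     (\<forall>f xs. length xs = ar f \<and> set xs \<subseteq> universe A \<longrightarrow> interp A f xs \<in> universe A)"

definition alg_hom :: "('f \<Rightarrow> nat) \<Rightarrow> ('a \<Rightarrow> 'b) \<Rightarrow> ('f, 'a) alg \<Rightarrow> ('f, 'b) alg \<Rightarrow> bool" where
  "alg_hom ar h A B \<longleftrightarrow> h ` universe A \<subseteq> universe B \<and>
     (\<forall>f xs. length xs = ar f \<and> set xs \<subseteq> universe A \<longrightarrow>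
        h (interp A f xs) = interp B f (map h xs))"

datatype (trm_funs: 'f, trm_vars: 'v) trm = Var 'v | Op 'f "('f, 'v) trm list"

fun wf_trm :: "('f \<Rightarrow> nat) \<Rightarrow> ('f, 'v) trm \<Rightarrow> bool" where
  "wf_trm ar (Var x) \<longleftrightarrow> True"
| "wf_trm ar (Op f ts) \<longleftrightarrow> length ts = ar f \<and> (\<forall>t\<in>set ts. wf_trm ar t)"

fun trm_value :: "('f, 'a) alg \<Rightarrow> ('v \<Rightarrow> 'a) \<Rightarrow> ('f, 'v) trm \<Rightarrow> 'a" where
  "trm_value A v (Var x) = v x"
| "trm_value A v (Op f ts) = interp A f (map (trm_value A v) ts)"

type_synonym 'f idents = "(('f, nat) trm \<times> ('f, nat) trm) set"

definition identities :: "('f \<Rightarrow> nat) \<Rightarrow> 'f idents" where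
  "identities ar = {(s, t). wf_trm ar s \<and> wf_trm ar t}"

definition satisfies :: "('f, 'a) alg \<Rightarrow> 'f idents \<Rightarrow> bool" where
  "satisfies A E \<longleftrightarrow> (\<forall>(s, t)\<in>E. \<forall>v. range v \<subseteq> universe A \<longrightarrow> trm_value A v s = trm_value A v t)"

text \<open>The variety (equational class) axiomatised by \<open>E\<close>. HOL has no class of algebras on
  arbitrary universes, so a class is represented by its members with universe a nonempty
  subset of a type, for an arbitrary type \<open>'u\<close>.\<close>

definition eq_class :: "('f \<Rightarrow> nat) \<Rightarrow> 'f idents \<Rightarrow> ('f, 'u) alg set" where
  "eq_class ar E = {M. wf_alg ar M \<and> satisfies M E}"

text \<open>The smallest variety containing \<open>K\<close>, i.e. the intersection of all varieties
  containing \<open>K\<close>. The algebras in \<open>K\<close> and the algebras of the generated variety may live on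
  different types.\<close>

definition variety_gen :: "('f \<Rightarrow> nat) \<Rightarrow> ('f, 'a) alg set \<Rightarrow> ('f, 'u) alg set" where
  "variety_gen ar K =
     (\<Inter>E \<in> {E. E \<subseteq> identities ar \<and> K \<subseteq> (eq_class ar E :: ('f, 'a) alg set)}. eq_class ar E)"


section \<open>The generated variety as HSP\<close>

text \<open>The theorem \<open>variety_gen_HSP\<close> below shows that \<open>variety_gen\<close> is the class of homomorphic
  images of subalgebras of products of members of \<open>K\<close>. The
  index type can be fixed there because products over valuations suffice;
  \<open>HSP_in_variety_gen\<close> allows any index type.\<close>

definition prod_alg :: "'i set \<Rightarrow> ('i \<Rightarrow> ('f, 'a) alg) \<Rightarrow> ('f, 'i \<Rightarrow> 'a) alg" where
  "prod_alg I A = \<lparr>universe = (\<Pi>\<^sub>E i\<in>I. universe (A i)),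
                   interp = (\<lambda>f xs. \<lambda>i\<in>I. interp (A i) f (map (\<lambda>x. x i) xs))\<rparr>"

definition subalg :: "('f \<Rightarrow> nat) \<Rightarrow> ('f, 'a) alg \<Rightarrow> ('f, 'a) alg \<Rightarrow> bool" where
  "subalg ar S A \<longleftrightarrow> wf_alg ar S \<and> universe S \<subseteq> universe A \<and>
     (\<forall>f xs. length xs = ar f \<and> set xs \<subseteq> universe S \<longrightarrow> interp S f xs = interp A f xs)"

lemma variety_gen_iff:
  "M \<in> variety_gen ar K \<longleftrightarrow>
     (\<forall>E \<subseteq> identities ar. K \<subseteq> eq_class ar E \<longrightarrow> M \<in> eq_class ar E)"
  by (auto simp: variety_gen_def)

lemma trm_value_cong:
  "(\<And>x. x \<in> trm_vars t \<Longrightarrow> v x = w x) \<Longrightarrow> trm_value A v t = trm_value A w t"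
proof (induction t)
  case (Op f ts)
  have "map (trm_value A v) ts = map (trm_value A w) ts"
  proof (rule map_cong[OF refl])
    fix t assume "t \<in> set ts"
    then show "trm_value A v t = trm_value A w t"
      by (rule Op.IH) (use Op.prems \<open>t \<in> set ts\<close> in auto)
  qed
  then show ?case by (simp only: trm_value.simps)
qed simp

lemma trm_value_in:
  assumes "wf_alg ar A" "wf_trm ar t" "v ` trm_vars t \<subseteq> universe A"
  shows "trm_value A v t \<in> universe A"
  using assms(2,3)
proof (induction t)
  case (Op f ts)
  have "set (map (trm_value A v) ts) \<subseteq> universe A"
    using Op by fastforce
  moreover have "length (map (trm_value A v) ts) = ar f"
    using Op.prems by simp
  ultimately have "interp A f (map (trm_value A v) ts) \<in> universe A"
    using assms(1) unfolding wf_alg_def by blast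
  then show ?case by simp
qed auto

lemma trm_value_hom:
  assumes h: "alg_hom ar h A B" and A: "wf_alg ar A"
    and t: "wf_trm ar t" "v ` trm_vars t \<subseteq> universe A"
  shows "h (trm_value A v t) = trm_value B (h \<circ> v) t"
  using t
proof (induction t)
  case (Op f ts)
  have ts: "wf_trm ar t" "v ` trm_vars t \<subseteq> universe A" if "t \<in> set ts" for t
    using Op.prems that by auto
  have "length (map (trm_value A v) ts) = ar f" using Op.prems by simp
  moreover have "set (map (trm_value A v) ts) \<subseteq> universe A"
    using trm_value_in[OF A ts] by auto
  ultimately have "h (interp A f (map (trm_value A v) ts)) = interp B f (map h (map (trm_value A v) ts))"
    using h unfolding alg_hom_def by blast
  also have "map h (map (trm_value A v) ts) = map (trm_value B (h \<circ> v)) ts"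
    using Op.IH ts by (simp add: comp_def)
  finally show ?case by (simp only: trm_value.simps)
qed simp

lemma trm_value_map:
  "trm_value A w (map_trm id r t) = trm_value A (w \<circ> r) t"
  by (induction t) (auto simp: comp_def intro!: arg_cong[where f = "interp A _"])

lemma wf_trm_map: "wf_trm ar (map_trm id r t) = wf_trm ar t"
  by (induction t) auto

lemma finite_trm_vars: "finite (trm_vars t)"
  by (induction t) auto

lemma proj_hom: "i \<in> I \<Longrightarrow> alg_hom ar (\<lambda>x. x i) (prod_alg I A) (A i)"
  by (auto simp: alg_hom_def prod_alg_def)

lemma HSP_in_variety_gen:
  fixes M :: "('f, 'u) alg" and A :: "'i \<Rightarrow> ('f, 'a) alg"
  assumes M: "wf_alg ar M"
    and A: "\<And>i. i \<in> I \<Longrightarrow> A i \<in> K"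
    and S: "subalg ar S (prod_alg I A)"
    and h: "alg_hom ar h S M" "h ` universe S = universe M"
  shows "M \<in> variety_gen ar K"
  unfolding variety_gen_iff
proof (intro allI impI)
  fix E assume E: "E \<subseteq> identities ar" and K: "K \<subseteq> eq_class ar E"
  have wfS: "wf_alg ar S" using S by (simp add: subalg_def)
  have SU: "universe S \<subseteq> (\<Pi>\<^sub>E i\<in>I. universe (A i))"
    using S by (simp add: subalg_def prod_alg_def)
  have "satisfies M E"
    unfolding satisfies_def
  proof clarify
    fix s t and v :: "nat \<Rightarrow> 'u" assume st: "(s, t) \<in> E" and v: "range v \<subseteq> universe M"
    have "\<exists>w. \<forall>n. w n \<in> universe S \<and> v n = h (w n)"
      using v h(2) by (intro choice) (metis imageE range_subsetD)
    then obtain w where w: "\<And>n. w n \<in> universe S" "\<And>n. v n = h (w n)" by blast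
    have vw: "v = h \<circ> w" using w by auto
    have wft: "wf_trm ar s" "wf_trm ar t" using st E by (auto simp: identities_def)
    have val_i: "trm_value S w r i = trm_value (A i) (\<lambda>n. w n i) r"
      if "wf_trm ar r" "i \<in> I" for r i
    proof -
      have "alg_hom ar (\<lambda>x. x i) S (A i)"
        using proj_hom[OF that(2), of ar A] S
        by (auto simp: alg_hom_def subalg_def subset_iff)
      from trm_value_hom[OF this wfS that(1), of w] w show ?thesis
        by (auto simp: comp_def)
    qed
    have "trm_value S w s = trm_value S w t"
    proof (rule PiE_ext)
      show "trm_value S w s \<in> (\<Pi>\<^sub>E i\<in>I. universe (A i))"
        "trm_value S w t \<in> (\<Pi>\<^sub>E i\<in>I. universe (A i))"
        using SU w wfS wft by (auto intro!: subsetD[OF SU] trm_value_in)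
      fix i assume i: "i \<in> I"
      have "range (\<lambda>n. w n i) \<subseteq> universe (A i)"
        using w(1) SU i by (auto simp: PiE_iff subset_iff)
      moreover have "satisfies (A i) E" using A[OF i] K by (auto simp: eq_class_def)
      ultimately show "trm_value S w s i = trm_value S w t i"
        using st by (auto simp: val_i wft i satisfies_def)
    qed
    moreover have "trm_value M v r = h (trm_value S w r)" if "wf_trm ar r" for r
    proof -
      have "w ` trm_vars r \<subseteq> universe S" using w(1) by auto
      from trm_value_hom[OF h(1) wfS that this] show ?thesis by (simp add: vw)
    qed
    ultimately show "trm_value M v s = trm_value M v t" by (simp add: wft)
  qed
  with M show "M \<in> eq_class ar E" by (simp add: eq_class_def)
qed

theorem variety_gen_HSP:
  fixes M :: "('f, 'u) alg" and K :: "('f, 'a) alg set"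
  assumes K: "\<And>A. A \<in> K \<Longrightarrow> wf_alg ar A"
  shows "M \<in> variety_gen ar K \<longleftrightarrow> wf_alg ar M \<and>
     (\<exists>(I :: (('f, 'a) alg \<times> ('u \<Rightarrow> 'a)) set) A S h. (\<forall>i\<in>I. A i \<in> K) \<and>
        subalg ar S (prod_alg I A) \<and> alg_hom ar h S M \<and> h ` universe S = universe M)"
    (is "?L \<longleftrightarrow> ?R")
proof
  assume ?R
  then obtain I :: "(('f, 'a) alg \<times> ('u \<Rightarrow> 'a)) set" and A S h
    where M: "wf_alg ar M" and A: "\<forall>i\<in>I. A i \<in> K" and S: "subalg ar S (prod_alg I A)"
      and h: "alg_hom ar h S M" "h ` universe S = universe M"
    by (elim conjE exE)
  show ?L by (rule HSP_in_variety_gen[OF M _ S h]) (use A in simp)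
next
  assume L: ?L
  have "K \<subseteq> eq_class ar {}" using K by (auto simp: eq_class_def satisfies_def)
  with L[unfolded variety_gen_iff, rule_format, of "{}"] have "M \<in> eq_class ar {}" by simp
  then have M: "wf_alg ar M" by (simp add: eq_class_def)
  then obtain m where m: "m \<in> universe M" by (auto simp: wf_alg_def)
  define I :: "(('f, 'a) alg \<times> ('u \<Rightarrow> 'a)) set" where
    "I = {(A, v). A \<in> K \<and> range v \<subseteq> universe A}"
  define T where "T = {t :: ('f, 'u) trm. wf_trm ar t \<and> trm_vars t \<subseteq> universe M}"
  define g where "g t = (\<lambda>i\<in>I. trm_value (fst i) (snd i) t)" for t :: "('f, 'u) trm"
  define P where "P = prod_alg I (fst :: ('f, 'a) alg \<times> ('u \<Rightarrow> 'a) \<Rightarrow> _)"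
  define S where "S = \<lparr>universe = g ` T, interp = interp P\<rparr>"
  have gP: "g t \<in> universe P" if "t \<in> T" for t
    using that K unfolding g_def P_def prod_alg_def T_def I_def
    by (fastforce intro!: trm_value_in)
  have val: "trm_value M id s = trm_value M id t" if s: "s \<in> T" and t: "t \<in> T" and st: "g s = g t" for s t
  proof -
    let ?X = "trm_vars s \<union> trm_vars t"
    have "finite ?X" by (simp add: finite_trm_vars)
    then obtain r :: "'u \<Rightarrow> nat" where r: "inj_on r ?X"
      using finite_imp_inj_to_nat_seg by blast
    let ?E = "{(map_trm id r s, map_trm id r t)}"
    have "?E \<subseteq> identities ar" using s t by (simp add: identities_def wf_trm_map T_def)
    moreover have "K \<subseteq> eq_class ar ?E"
    proof
      fix A assume A: "A \<in> K"
      have "trm_value A (w \<circ> r) s = trm_value A (w \<circ> r) t" if "range w \<subseteq> universe A" for w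
      proof -
        have "(A, w \<circ> r) \<in> I" using A that by (auto simp: I_def)
        with fun_cong[OF st, of "(A, w \<circ> r)"] show ?thesis by (simp add: g_def)
      qed
      with K[OF A] show "A \<in> eq_class ar ?E"
        by (simp add: eq_class_def satisfies_def trm_value_map)
    qed
    ultimately have "M \<in> eq_class ar ?E" using L[unfolded variety_gen_iff, rule_format, of ?E] by simp
    then have E: "satisfies M ?E" by (simp add: eq_class_def)
    define w where "w n = (if n \<in> r ` ?X then inv_into ?X r n else m)" for n
    have w: "w (r x) = x" if "x \<in> ?X" for x
      using that r unfolding w_def by (simp add: inv_into_f_f)
    have "range w \<subseteq> universe M"
    proof clarify
      fix n
      have "?X \<subseteq> universe M" using s t by (auto simp: T_def)
      then show "w n \<in> universe M" using m inv_into_into[of n r ?X] by (auto simp: w_def)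
    qed
    with E have "trm_value M (w \<circ> r) s = trm_value M (w \<circ> r) t"
      by (simp add: satisfies_def trm_value_map)
    moreover have "trm_value M (w \<circ> r) s = trm_value M id s" "trm_value M (w \<circ> r) t = trm_value M id t"
      by (rule trm_value_cong, use w in simp)+
    ultimately show ?thesis by simp
  qed
  define h where "h y = trm_value M id (inv_into T g y)" for y
  have hg: "h (g t) = trm_value M id t" if "t \<in> T" for t
    unfolding h_def by (rule val) (use that in \<open>auto intro: inv_into_into f_inv_into_f\<close>)
  have gOp: "interp P f (map g ts) = g (Op f ts)" for f ts
    by (auto simp: P_def prod_alg_def g_def comp_def fun_eq_iff)
  have lift: "\<exists>ts. set ts \<subseteq> T \<and> xs = map g ts" if "set xs \<subseteq> g ` T" for xs
    using that by (intro exI[of _ "map (inv_into T g) xs"])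
      (auto simp: subset_iff intro!: inv_into_into map_idI[symmetric] simp: f_inv_into_f)
  have OpT: "Op f ts \<in> T" if "length ts = ar f" "set ts \<subseteq> T" for f ts
    using that by (auto simp: T_def)
  have VarT: "Var x \<in> T" if "x \<in> universe M" for x using that by (simp add: T_def)
  have "wf_alg ar S"
    unfolding wf_alg_def
  proof (intro conjI allI impI)
    show "universe S \<noteq> {}" using VarT[OF m] by (auto simp: S_def)
    fix f xs assume "length xs = ar f \<and> set xs \<subseteq> universe S"
    with lift[of xs] OpT show "interp S f xs \<in> universe S"
      by (auto simp: S_def gOp)
  qed
  then have "subalg ar S P" using gP by (auto simp: subalg_def S_def)
  moreover have "alg_hom ar h S M"
    unfolding alg_hom_def
  proof (intro conjI allI impI)
    show "h ` universe S \<subseteq> universe M"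
      using M unfolding S_def by (auto simp: hg) (auto simp: T_def intro!: trm_value_in)
    fix f xs assume xs: "length xs = ar f \<and> set xs \<subseteq> universe S"
    then obtain ts where ts: "set ts \<subseteq> T" "xs = map g ts" using lift by (auto simp: S_def)
    have hts: "map h xs = map (trm_value M id) ts" using ts hg by auto
    have "interp S f xs = g (Op f ts)" by (simp add: S_def ts(2) gOp)
    moreover have "Op f ts \<in> T" using xs ts by (simp add: OpT)
    ultimately show "h (interp S f xs) = interp M f (map h xs)"
      by (simp only: hts hg trm_value.simps)
  qed
  moreover have "h ` universe S = universe M"
  proof
    show "h ` universe S \<subseteq> universe M" using \<open>alg_hom ar h S M\<close> by (simp add: alg_hom_def)
    show "universe M \<subseteq> h ` universe S"
    proof
      fix x assume "x \<in> universe M"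
      with hg[OF VarT] have "x = h (g (Var x))" "g (Var x) \<in> universe S"
        using VarT by (auto simp: S_def)
      then show "x \<in> h ` universe S" by blast
    qed
  qed
  moreover have "\<forall>i\<in>I. fst i \<in> K" by (auto simp: I_def)
  ultimately show ?R using M unfolding P_def
    by (intro conjI exI[of _ I] exI[of _ fst] exI[of _ S] exI[of _ h]) auto
qed


section \<open>MV-algebras\<close>

datatype mv_op = Oplus | Neg | Zero

fun mv_arity :: "mv_op \<Rightarrow> nat" where
  "mv_arity Oplus = 2"
| "mv_arity Neg = 1"
| "mv_arity Zero = 0"

definition oplus :: "(mv_op, 'a) alg \<Rightarrow> 'a \<Rightarrow> 'a \<Rightarrow> 'a" where
  "oplus A x y = interp A Oplus [x, y]"

definition neg :: "(mv_op, 'a) alg \<Rightarrow> 'a \<Rightarrow> 'a" where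
  "neg A x = interp A Neg [x]"

definition zero :: "(mv_op, 'a) alg \<Rightarrow> 'a" where
  "zero A = interp A Zero []"

definition one :: "(mv_op, 'a) alg \<Rightarrow> 'a" where
  "one A = neg A (zero A)"

definition imp :: "(mv_op, 'a) alg \<Rightarrow> 'a \<Rightarrow> 'a \<Rightarrow> 'a" where
  "imp A x y = oplus A (neg A x) y"

definition mv_algebra :: "(mv_op, 'a) alg \<Rightarrow> bool" where
  "mv_algebra A \<longleftrightarrow> wf_alg mv_arity A \<and>
     (\<forall>x\<in>universe A. \<forall>y\<in>universe A. \<forall>z\<in>universe A.
        oplus A (oplus A x y) z = oplus A x (oplus A y z)) \<and>
     (\<forall>x\<in>universe A. \<forall>y\<in>universe A. oplus A x y = oplus A y x) \<and>
     (\<forall>x\<in>universe A. oplus A x (zero A) = x) \<and>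
     (\<forall>x\<in>universe A. neg A (neg A x) = x) \<and>
     (\<forall>x\<in>universe A. oplus A x (one A) = one A) \<and>
     (\<forall>x\<in>universe A. \<forall>y\<in>universe A. imp A (imp A x y) y = imp A (imp A y x) x)"

definition mk_mv :: "'a set \<Rightarrow> ('a \<Rightarrow> 'a \<Rightarrow> 'a) \<Rightarrow> ('a \<Rightarrow> 'a) \<Rightarrow> 'a \<Rightarrow> (mv_op, 'a) alg" where
  "mk_mv U p n z = \<lparr>universe = U,
     interp = (\<lambda>f xs. case f of Oplus \<Rightarrow> p (xs ! 0) (xs ! 1) | Neg \<Rightarrow> n (xs ! 0) | Zero \<Rightarrow> z)\<rparr>"

definition unit_interval_mv :: "(mv_op, real) alg" where
  "unit_interval_mv = mk_mv {0..1} (\<lambda>r s. min (r + s) 1) (\<lambda>r. 1 - r) 0"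

text \<open>The group structure on \<open>int \<times> int\<close> is componentwise. The lexicographic order is written
  out, since the type class instances of the library for the order on pairs (componentwise and
  lexicographic) exclude each other.\<close>

definition lex_le :: "int \<times> int \<Rightarrow> int \<times> int \<Rightarrow> bool" where
  "lex_le x y \<longleftrightarrow> fst x < fst y \<or> fst x = fst y \<and> snd x \<le> snd y"

definition lex_min :: "int \<times> int \<Rightarrow> int \<times> int \<Rightarrow> int \<times> int" where
  "lex_min x y = (if lex_le x y then x else y)"

definition chang_mv :: "(mv_op, int \<times> int) alg" where
  "chang_mv = mk_mv {x. lex_le (0, 0) x \<and> lex_le x (1, 0)}
     (\<lambda>x y. lex_min (x + y) (1, 0)) (\<lambda>x. (1, 0) - x) (0, 0)"


section \<open>SMMV-algebras\<close>

datatype smmv_op = MV mv_op | Tau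

fun smmv_arity :: "smmv_op \<Rightarrow> nat" where
  "smmv_arity (MV f) = mv_arity f"
| "smmv_arity Tau = 1"

definition mv_reduct :: "(smmv_op, 'a) alg \<Rightarrow> (mv_op, 'a) alg" where
  "mv_reduct S = \<lparr>universe = universe S, interp = (\<lambda>f. interp S (MV f))\<rparr>"

definition tau :: "(smmv_op, 'a) alg \<Rightarrow> 'a \<Rightarrow> 'a" where
  "tau S x = interp S Tau [x]"

definition smmv_algebra :: "(smmv_op, 'a) alg \<Rightarrow> bool" where
  "smmv_algebra S \<longleftrightarrow> mv_algebra (mv_reduct S) \<and>
     alg_hom mv_arity (tau S) (mv_reduct S) (mv_reduct S) \<and>
     (\<forall>x\<in>universe S. tau S (tau S x) = tau S x)"

definition smmv_class :: "(mv_op, 'u) alg set \<Rightarrow> (smmv_op, 'u) alg set" where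
  "smmv_class \<V> = {S. smmv_algebra S \<and> mv_reduct S \<in> \<V>}"

definition mk_smmv :: "(mv_op, 'a) alg \<Rightarrow> ('a \<Rightarrow> 'a) \<Rightarrow> (smmv_op, 'a) alg" where
  "mk_smmv A t = \<lparr>universe = universe A,
     interp = (\<lambda>f xs. case f of MV g \<Rightarrow> interp A g xs | Tau \<Rightarrow> t (xs ! 0))\<rparr>"

definition square_mv :: "(mv_op, 'a) alg \<Rightarrow> (mv_op, 'a \<times> 'a) alg" where
  "square_mv A = \<lparr>universe = universe A \<times> universe A,
     interp = (\<lambda>f ps. (interp A f (map fst ps), interp A f (map snd ps)))\<rparr>"

definition diag_smmv :: "(mv_op, 'a) alg \<Rightarrow> (smmv_op, 'a \<times> 'a) alg" where
  "diag_smmv A = mk_smmv (square_mv A) (\<lambda>(a, b). (a, a))"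

text \<open>An equation between generated varieties at an arbitrary type \<open>'u\<close> says that they have the same
  members among the algebras on subsets of \<open>'u\<close>.\<close>

abbreviation V_MV :: "(mv_op, 'a) alg \<Rightarrow> (mv_op, 'u) alg set" where
  "V_MV A \<equiv> variety_gen mv_arity {A}"

abbreviation V_SMMV :: "(smmv_op, 'a) alg \<Rightarrow> (smmv_op, 'u) alg set" where
  "V_SMMV S \<equiv> variety_gen smmv_arity {S}"


section \<open>The algebras above are of the intended kind\<close>

lemma wf_mk_mv:
  assumes "\<And>x y. x \<in> U \<Longrightarrow> y \<in> U \<Longrightarrow> p x y \<in> U" "\<And>x. x \<in> U \<Longrightarrow> n x \<in> U" "z \<in> U"
  shows "wf_alg mv_arity (mk_mv U p n z)"
  unfolding wf_alg_def
proof (intro conjI allI impI)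
  show "universe (mk_mv U p n z) \<noteq> {}" using assms(3) by (auto simp: mk_mv_def)
  fix f xs assume xs: "length xs = mv_arity f \<and> set xs \<subseteq> universe (mk_mv U p n z)"
  then have "xs ! k \<in> U" if "k < mv_arity f" for k
    using that by (auto simp: mk_mv_def)
  with assms show "interp (mk_mv U p n z) f xs \<in> universe (mk_mv U p n z)"
    by (cases f) (auto simp: mk_mv_def)
qed

lemma mk_mv_simps [simp]:
  "universe (mk_mv U p n z) = U" "oplus (mk_mv U p n z) = p" "neg (mk_mv U p n z) = n"
  "zero (mk_mv U p n z) = z"
  by (auto simp: mk_mv_def oplus_def neg_def zero_def fun_eq_iff)

lemma mv_algebra_unit_interval: "mv_algebra unit_interval_mv"
  unfolding mv_algebra_def
proof (intro conjI)
  show "wf_alg mv_arity unit_interval_mv"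
    unfolding unit_interval_mv_def by (rule wf_mk_mv) auto
qed (auto simp: unit_interval_mv_def one_def imp_def min_def)

lemma mv_algebra_chang: "mv_algebra chang_mv"
proof -
  define p where "p x y = lex_min (x + y) (1, 0)" for x y
  define n :: "int \<times> int \<Rightarrow> int \<times> int" where "n x = (1, 0) - x" for x
  let ?U = "{x. lex_le (0, 0) x \<and> lex_le x (1, 0)}"
  have U: "(\<exists>a\<ge>0. x = (0, a)) \<or> (\<exists>a\<le>0. x = (1, a))" if "x \<in> ?U" for x
    using that by (cases x) (auto simp: lex_le_def)
  have pn [simp]: "p (0, a) (0, b) = (0, a + b)" "p (0, a) (1, b) = (1, min (a + b) 0)"
    "p (1, a) (0, b) = (1, min (a + b) 0)" "p (1, a) (1, b) = (1, 0)"
    "n (0, a) = (1, - a)" "n (1, a) = (0, - a)" for a b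
    by (auto simp: p_def n_def lex_min_def lex_le_def)
  have chang: "chang_mv = mk_mv ?U p n (0, 0)"
    unfolding chang_mv_def p_def n_def ..
  have pU: "p x y \<in> ?U" if "x \<in> ?U" "y \<in> ?U" for x y
    using U[OF that(1)] U[OF that(2)] by (elim disjE exE conjE) (simp_all add: lex_le_def)
  have nU: "n x \<in> ?U" if "x \<in> ?U" for x
    using U[OF that] by (elim disjE exE conjE) (simp_all add: lex_le_def)
  have wf: "wf_alg mv_arity chang_mv"
    unfolding chang by (rule wf_mk_mv[OF pU nU]) (simp_all add: lex_le_def)
  have assoc: "p (p x y) z = p x (p y z)" if "x \<in> ?U" "y \<in> ?U" "z \<in> ?U" for x y z
    using U[OF that(1)] U[OF that(2)] U[OF that(3)]
    by (elim disjE exE conjE) (simp_all add: min_def)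
  have comm: "p x y = p y x" for x y
    by (simp add: p_def add.commute)
  have unit: "p x (0, 0) = x" "n (n x) = x" "p x (1, 0) = (1, 0)" if "x \<in> ?U" for x
    using U[OF that] by (elim disjE exE conjE; simp)+
  have imp: "p (n (p (n x) y)) y = p (n (p (n y) x)) x" if "x \<in> ?U" "y \<in> ?U" for x y
    using U[OF that(1)] U[OF that(2)]
    by (elim disjE exE conjE) (simp_all add: min_def)
  have one: "one chang_mv = (1, 0)" by (simp add: one_def chang)
  show ?thesis
    unfolding mv_algebra_def one imp_def
    using wf assoc comm unit imp by (simp add: chang)
qed

lemma smmv_algebra_diag:
  assumes A: "mv_algebra A"
  shows "smmv_algebra (diag_smmv A)"
proof -
  have wf: "wf_alg mv_arity A" using A by (simp add: mv_algebra_def)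
  have r: "mv_reduct (diag_smmv A) = square_mv A"
    by (simp add: mv_reduct_def diag_smmv_def mk_smmv_def square_mv_def)
  have t: "tau (diag_smmv A) = (\<lambda>(a, b). (a, a))"
    by (auto simp: tau_def diag_smmv_def mk_smmv_def)
  have "wf_alg mv_arity (square_mv A)"
    unfolding wf_alg_def
  proof (intro conjI allI impI)
    show "universe (square_mv A) \<noteq> {}" using wf by (auto simp: wf_alg_def square_mv_def)
    fix f xs assume xs: "length xs = mv_arity f \<and> set xs \<subseteq> universe (square_mv A)"
    then have "set (map fst xs) \<subseteq> universe A" "set (map snd xs) \<subseteq> universe A"
      by (auto simp: square_mv_def)
    with xs wf have "interp A f (map fst xs) \<in> universe A" "interp A f (map snd xs) \<in> universe A"
      by (metis length_map wf_alg_def)+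
    then show "interp (square_mv A) f xs \<in> universe (square_mv A)" by (simp add: square_mv_def)
  qed
  moreover have "oplus (square_mv A) = (\<lambda>x y. (oplus A (fst x) (fst y), oplus A (snd x) (snd y)))"
    "neg (square_mv A) = (\<lambda>x. (neg A (fst x), neg A (snd x)))"
    "zero (square_mv A) = (zero A, zero A)" "universe (square_mv A) = universe A \<times> universe A"
    by (auto simp: square_mv_def oplus_def neg_def zero_def fun_eq_iff)
  ultimately have "mv_algebra (square_mv A)"
    using A by (auto simp: mv_algebra_def one_def imp_def)
  moreover have "alg_hom mv_arity (\<lambda>(a, b). (a, a)) (square_mv A) (square_mv A)"
    by (auto simp: alg_hom_def square_mv_def comp_def case_prod_unfold)
  ultimately show ?thesis
    by (auto simp: smmv_algebra_def r t)
qed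

end

theory Submission
  imports "HOL-Algebra.FiniteProduct" Defs
begin

text \<open>Two independent facts carry the theorem.

SMMV-algebras sit inside diagonal algebras. If \<open>\<tau>\<close> is an
idempotent endomorphism, then \<open>x \<mapsto> (\<tau> x, x)\<close> embeds an SMMV-algebra
\<open>S\<close> into \<open>D(A)\<close>, where \<open>A\<close> is its MV-reduct: the element
\<open>\<tau> x\<close> goes to \<open>(\<tau> (\<tau> x), \<tau> x) = (\<tau> x, \<tau> x)\<close>,
which is what the operator of \<open>D(A)\<close> makes of \<open>(\<tau> x, x)\<close>. On the level of
terms this means that an SMMV-term is an MV-term in two kinds of variables, one kind for \<open>x\<close> and
one for \<open>\<tau> x\<close> (\<open>split_trm\<close>). An SMMV-identity of \<open>D(A)\<close> thereby
becomes an MV-identity of \<open>A\<close> (\<open>holds_split_trm\<close>), and an MV-identity of the reduct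
of \<open>S\<close> obtained in this way comes from an SMMV-identity of \<open>S\<close>
(\<open>holds_of_split_trm\<close>). So a variety of MV-algebras generated by \<open>A\<close> lifts to the
variety generated by \<open>D(A)\<close> (\<open>V_diag_smmv\<close>). Conversely, the variety of
\<open>A\<close> can be read off from that of \<open>D(A)\<close>, since \<open>(M, id)\<close> is an
SMMV-algebra for every MV-algebra \<open>M\<close>.

The real unit interval generates all MV-algebras. This is Chang's completeness
theorem (\<open>unit_interval_complete\<close>). If an identity fails in \<open>M\<close>, it gives rise to a
nonzero value of some term. By Zorn's lemma there is a prime ideal avoiding this value, and the quotient by it
is a chain in which the value is still nonzero (\<open>chain_quotient_separating\<close>). A nontrivial chain
is the unit interval of an ordered abelian group, whose elements are pairs of an integer and a proper
fraction, added with a carry (\<open>comm_group_chain_group\<close>). The value of the term is determined by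
finitely many equations and inequalities between sums of two elements of that group. Fourier-Motzkin
elimination shows that any finite system of homogeneous linear inequalities with integer coefficients that is
solvable in an ordered abelian group is solvable in the reals (\<open>fourier_motzkin\<close>,
\<open>ordered_group_real_solution\<close>), and a real solution is, after rescaling, a valuation in
\<open>[0,1]\<close> under which the term is positive (\<open>real_valuation\<close>).\<close>

section \<open>Identities and the variety generated by one algebra\<close>

definition holds :: "('f, 'a) alg \<Rightarrow> ('f, nat) trm \<Rightarrow> ('f, nat) trm \<Rightarrow> bool" where
  "holds A s t \<longleftrightarrow> (\<forall>v. range v \<subseteq> universe A \<longrightarrow> trm_value A v s = trm_value A v t)"

lemma variety_gen_singleton_iff:
  assumes "wf_alg ar A"
  shows "M \<in> variety_gen ar {A} \<longleftrightarrow> wf_alg ar M \<and>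
    (\<forall>s t. wf_trm ar s \<and> wf_trm ar t \<and> holds A s t \<longrightarrow> holds M s t)"
proof
  assume M: "M \<in> variety_gen ar {A}"
  have "M \<in> eq_class ar {(s, t)}" if "wf_trm ar s" "wf_trm ar t" "holds A s t" for s t
  proof -
    have "{(s, t)} \<subseteq> identities ar" "{A} \<subseteq> eq_class ar {(s, t)}"
      using that assms by (auto simp: identities_def eq_class_def satisfies_def holds_def)
    with M show ?thesis unfolding variety_gen_iff by blast
  qed
  moreover have "wf_alg ar M"
  proof -
    have "{} \<subseteq> identities ar" "{A} \<subseteq> eq_class ar {}"
      using assms by (auto simp: eq_class_def satisfies_def)
    with M have "M \<in> eq_class ar {}" unfolding variety_gen_iff by blast
    then show ?thesis by (simp add: eq_class_def)
  qed
  ultimately show "wf_alg ar M \<and>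
    (\<forall>s t. wf_trm ar s \<and> wf_trm ar t \<and> holds A s t \<longrightarrow> holds M s t)"
    by (auto simp: eq_class_def satisfies_def holds_def)
next
  assume M: "wf_alg ar M \<and> (\<forall>s t. wf_trm ar s \<and> wf_trm ar t \<and> holds A s t \<longrightarrow> holds M s t)"
  show "M \<in> variety_gen ar {A}"
    unfolding variety_gen_iff
  proof (intro allI impI)
    fix E assume E: "E \<subseteq> identities ar" "{A} \<subseteq> eq_class ar E"
    have "holds M s t" if "(s, t) \<in> E" for s t
    proof -
      have "wf_trm ar s" "wf_trm ar t" "holds A s t"
        using that E by (auto simp: identities_def eq_class_def satisfies_def holds_def)
      then show ?thesis using M by blast
    qed
    then show "M \<in> eq_class ar E"
      using M by (auto simp: eq_class_def satisfies_def holds_def)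
  qed
qed

lemma mv_algebra_wf: "mv_algebra A \<Longrightarrow> wf_alg mv_arity A"
  by (simp add: mv_algebra_def)

lemma wf_alg_mvI:
  assumes "U \<noteq> {}" "\<And>x y. x \<in> U \<Longrightarrow> y \<in> U \<Longrightarrow> oplus A x y \<in> U" "\<And>x. x \<in> U \<Longrightarrow> neg A x \<in> U"
    "zero A \<in> U" "universe A = U"
  shows "wf_alg mv_arity A"
  unfolding wf_alg_def
proof (intro conjI allI impI)
  fix f xs assume xs: "length xs = mv_arity f \<and> set xs \<subseteq> universe A"
  show "interp A f xs \<in> universe A"
  proof (cases f)
    case Oplus
    then obtain x y where "xs = [x, y]" using xs by (auto simp: numeral_2_eq_2 length_Suc_conv)
    then show ?thesis using assms xs Oplus by (auto simp: oplus_def)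
  next
    case Neg
    then obtain x where "xs = [x]" using xs by (auto simp: length_Suc_conv)
    then show ?thesis using assms xs Neg by (auto simp: neg_def)
  next
    case Zero
    then show ?thesis using assms xs by (auto simp: zero_def)
  qed
qed (use assms in auto)

abbreviation oplusT :: "(mv_op, 'v) trm \<Rightarrow> (mv_op, 'v) trm \<Rightarrow> (mv_op, 'v) trm" where
  "oplusT s t \<equiv> Op Oplus [s, t]"

abbreviation negT :: "(mv_op, 'v) trm \<Rightarrow> (mv_op, 'v) trm" where
  "negT t \<equiv> Op Neg [t]"

abbreviation zeroT :: "(mv_op, 'v) trm" where
  "zeroT \<equiv> Op Zero []"

abbreviation impT :: "(mv_op, 'v) trm \<Rightarrow> (mv_op, 'v) trm \<Rightarrow> (mv_op, 'v) trm" where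
  "impT s t \<equiv> oplusT (negT s) t"

text \<open>Three variables suffice for the axioms of MV-algebras, so an identity between terms in the
variables 0, 1, 2 can be read as a statement about three elements.\<close>

lemma holds3D:
  assumes "holds M s t" "x \<in> universe M" "y \<in> universe M" "z \<in> universe M"
  shows "trm_value M (\<lambda>n. if n = 0 then x else if n = 1 then y else z) s =
    trm_value M (\<lambda>n. if n = 0 then x else if n = 1 then y else z) t"
  using assms unfolding holds_def by (elim allE impE) auto

lemma mv_algebra_iff_holds:
  "mv_algebra A \<longleftrightarrow> wf_alg mv_arity A \<and>
     holds A (oplusT (oplusT (Var 0) (Var 1)) (Var 2)) (oplusT (Var 0) (oplusT (Var 1) (Var 2))) \<and>
     holds A (oplusT (Var 0) (Var 1)) (oplusT (Var 1) (Var 0)) \<and>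
     holds A (oplusT (Var 0) zeroT) (Var 0) \<and>
     holds A (negT (negT (Var 0))) (Var 0) \<and>
     holds A (oplusT (Var 0) (negT zeroT)) (negT zeroT) \<and>
     holds A (impT (impT (Var 0) (Var 1)) (Var 1)) (impT (impT (Var 1) (Var 0)) (Var 0))"
  (is "_ \<longleftrightarrow> ?R")
proof
  assume "mv_algebra A"
  then show ?R
    by (auto simp: mv_algebra_def holds_def oplus_def neg_def zero_def one_def imp_def range_subsetD)
next
  assume R: ?R
  then have "holds A (oplusT (oplusT (Var 0) (Var 1)) (Var 2)) (oplusT (Var 0) (oplusT (Var 1) (Var 2)))"
     "holds A (oplusT (Var 0) (Var 1)) (oplusT (Var 1) (Var 0))"
     "holds A (oplusT (Var 0) zeroT) (Var 0)"
     "holds A (negT (negT (Var 0))) (Var 0)"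
     "holds A (oplusT (Var 0) (negT zeroT)) (negT zeroT)"
     "holds A (impT (impT (Var 0) (Var 1)) (Var 1)) (impT (impT (Var 1) (Var 0)) (Var 0))"
    by auto
  note h = this[THEN holds3D]
  from R show "mv_algebra A"
    unfolding mv_algebra_def one_def imp_def oplus_def neg_def zero_def
    using h by auto
qed

lemma mv_algebra_in_variety:
  assumes A: "mv_algebra A" and M: "M \<in> V_MV A"
  shows "mv_algebra M"
proof -
  have wf: "wf_alg mv_arity A" using A by (rule mv_algebra_wf)
  have M': "wf_alg mv_arity M"
    "wf_trm mv_arity s \<and> wf_trm mv_arity t \<Longrightarrow> holds A s t \<Longrightarrow> holds M s t" for s t
    using M unfolding variety_gen_singleton_iff[OF wf] by auto
  show ?thesis
    using A unfolding mv_algebra_iff_holds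
    by (elim conjE) (intro conjI M', simp_all)
qed

section \<open>SMMV-algebras inside diagonal algebras\<close>

text \<open>The image of a term under \<open>\<tau>\<close>: as \<open>\<tau>\<close> is an idempotent
endomorphism, it can be pushed down to the variables and absorbs every inner occurrence of itself, so only its
effect on the variables remains. In a well-formed term \<open>Tau\<close> has one argument, the head of the
list.\<close>

fun erase_tau :: "(smmv_op, 'v) trm \<Rightarrow> (mv_op, 'v) trm" where
  "erase_tau (Var x) = Var x"
| "erase_tau (Op (MV f) ts) = Op f (map erase_tau ts)"
| "erase_tau (Op Tau ts) = hd (map erase_tau ts)"

text \<open>A variable \<open>(False, x)\<close> stands for \<open>x\<close>, a variable
\<open>(True, x)\<close> for \<open>\<tau> x\<close>.\<close>

fun split_tau :: "(smmv_op, 'v) trm \<Rightarrow> (mv_op, bool \<times> 'v) trm" where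
  "split_tau (Var x) = Var (False, x)"
| "split_tau (Op (MV f) ts) = Op f (map split_tau ts)"
| "split_tau (Op Tau ts) = map_trm id (Pair True) (erase_tau (hd ts))"

lemma wf_erase_tau: "wf_trm smmv_arity t \<Longrightarrow> wf_trm mv_arity (erase_tau t)"
  by (induction t rule: erase_tau.induct) (auto simp: length_Suc_conv)

lemma wf_split_tau: "wf_trm smmv_arity t \<Longrightarrow> wf_trm mv_arity (split_tau t)"
  by (induction t rule: split_tau.induct) (auto simp: length_Suc_conv wf_trm_map wf_erase_tau)

lemma mv_reduct_simps [simp]:
  "universe (mv_reduct S) = universe S" "interp (mv_reduct S) f = interp S (MV f)"
  by (simp_all add: mv_reduct_def)

lemma wf_alg_smmv:
  assumes "smmv_algebra S"
  shows "wf_alg smmv_arity S"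
proof -
  have wf: "wf_alg mv_arity (mv_reduct S)"
    and t: "x \<in> universe S \<Longrightarrow> tau S x \<in> universe S" for x
    using assms by (auto simp: smmv_algebra_def mv_algebra_def alg_hom_def)
  show ?thesis
    unfolding wf_alg_def
  proof (intro conjI allI impI)
    show "universe S \<noteq> {}" using wf by (simp add: wf_alg_def)
    fix f xs assume xs: "length xs = smmv_arity f \<and> set xs \<subseteq> universe S"
    show "interp S f xs \<in> universe S"
    proof (cases f)
      case (MV g)
      then show ?thesis using wf xs by (auto simp: wf_alg_def)
    next
      case Tau
      then obtain x where "xs = [x]" using xs by (auto simp: length_Suc_conv)
      then show ?thesis using t xs Tau by (auto simp: tau_def)
    qed
  qed
qed

lemma tau_trm_value:
  assumes S: "smmv_algebra S" and v: "range v \<subseteq> universe S" and t: "wf_trm smmv_arity t"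
  shows "tau S (trm_value S v t) = trm_value (mv_reduct S) (tau S \<circ> v) (erase_tau t)"
  using t
proof (induction t rule: erase_tau.induct)
  case (2 f ts)
  have hom: "alg_hom mv_arity (tau S) (mv_reduct S) (mv_reduct S)"
    using S by (simp add: smmv_algebra_def)
  have "set (map (trm_value S v) ts) \<subseteq> universe S"
  proof -
    have "trm_value S v t \<in> universe S" if "t \<in> set ts" for t
      by (rule trm_value_in[OF wf_alg_smmv[OF S]]) (use 2 v that in auto)
    then show ?thesis by auto
  qed
  moreover have "length (map (trm_value S v) ts) = mv_arity f" using 2 by simp
  ultimately have "tau S (interp S (MV f) (map (trm_value S v) ts)) =
      interp S (MV f) (map (tau S) (map (trm_value S v) ts))"
    using hom unfolding alg_hom_def mv_reduct_simps by blast
  moreover have "map (tau S) (map (trm_value S v) ts) =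
      map (trm_value (mv_reduct S) (tau S \<circ> v)) (map erase_tau ts)"
    using 2 by (simp add: comp_def)
  ultimately show ?case by (simp only: trm_value.simps erase_tau.simps mv_reduct_simps)
next
  case (3 ts)
  then obtain t where ts: "ts = [t]" by (auto simp: length_Suc_conv)
  have "trm_value S v t \<in> universe S"
    using 3 v ts trm_value_in[OF wf_alg_smmv[OF S], of t v] by auto
  from this have "tau S (tau S (trm_value S v t)) = tau S (trm_value S v t)"
    using S by (simp add: smmv_algebra_def)
  then show ?case using 3 ts by (simp add: tau_def)
qed simp

lemma trm_value_split_tau:
  assumes S: "smmv_algebra S" and v: "range v \<subseteq> universe S" and t: "wf_trm smmv_arity t"
  shows "trm_value S v t =
    trm_value (mv_reduct S) (\<lambda>(b, n). if b then tau S (v n) else v n) (split_tau t)"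
  using t
proof (induction t rule: split_tau.induct)
  case (2 f ts)
  then show ?case by (auto intro!: arg_cong[where f = "interp S (MV f)"])
next
  case (3 ts)
  then obtain t where ts: "ts = [t]" by (auto simp: length_Suc_conv)
  show ?case using 3 ts tau_trm_value[OF S v, of t]
    by (simp add: trm_value_map tau_def comp_def)
qed simp

lemma diag_smmv_simps [simp]:
  "universe (diag_smmv A) = universe A \<times> universe A"
  "tau (diag_smmv A) p = (fst p, fst p)"
  "mv_reduct (diag_smmv A) = square_mv A"
  by (auto simp: diag_smmv_def mk_smmv_def square_mv_def tau_def mv_reduct_def split: prod.split)

lemma trm_value_square_mv:
  "trm_value (square_mv A) v t = (trm_value A (fst \<circ> v) t, trm_value A (snd \<circ> v) t)"
  by (induction t) (auto simp: square_mv_def comp_def intro!: arg_cong[where f = "interp A _"])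

lemma trm_value_embed_mv:
  "trm_value S v (map_trm MV id t) = trm_value (mv_reduct S) v t"
  by (induction t) (auto intro!: arg_cong[where f = "interp S _"])

lemma wf_embed_mv: "wf_trm mv_arity t \<Longrightarrow> wf_trm smmv_arity (map_trm MV id t)"
  by (induction t) auto

text \<open>Identities have natural numbers as variables, so the two kinds of variables are
interleaved.\<close>

definition flatten_var :: "bool \<times> nat \<Rightarrow> nat" where
  "flatten_var = (\<lambda>(b, n). 2 * n + (if b then 0 else 1))"

definition split_trm :: "(smmv_op, nat) trm \<Rightarrow> (mv_op, nat) trm" where
  "split_trm t = map_trm id flatten_var (split_tau t)"

text \<open>A valuation of the flattened variables in \<open>A\<close> assigns to \<open>x\<close> a pair of
elements, that is, an element of \<open>D(A)\<close>; the second component of the value of a term in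
\<open>D(A)\<close> is then the value of its split term in \<open>A\<close>.\<close>

lemma holds_split_trm:
  assumes A: "mv_algebra A" and wf: "wf_trm smmv_arity s" "wf_trm smmv_arity t"
    and h: "holds (diag_smmv A) s t"
  shows "holds A (split_trm s) (split_trm t)"
  unfolding holds_def
proof (intro allI impI)
  fix w :: "nat \<Rightarrow> 'a" assume w: "range w \<subseteq> universe A"
  define v where "v n = (w (2 * n), w (2 * n + 1))" for n
  have v: "range v \<subseteq> universe (diag_smmv A)" using w by (auto simp: v_def)
  have "w \<circ> flatten_var = snd \<circ> (\<lambda>(b, n). if b then tau (diag_smmv A) (v n) else v n)"
    by (auto simp: fun_eq_iff flatten_var_def v_def)
  then have "trm_value A w (split_trm r) = snd (trm_value (diag_smmv A) v r)"
    if "wf_trm smmv_arity r" for r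
    using trm_value_split_tau[OF smmv_algebra_diag[OF A] v that]
    by (simp add: split_trm_def trm_value_map trm_value_square_mv)
  with wf v h show "trm_value A w (split_trm s) = trm_value A w (split_trm t)"
    by (simp add: holds_def)
qed

text \<open>The valuations that send the two copies of a variable to \<open>\<tau> (v x)\<close> and
\<open>v x\<close> recover the values of the original terms.\<close>

lemma holds_of_split_trm:
  assumes S: "smmv_algebra S" and wf: "wf_trm smmv_arity s" "wf_trm smmv_arity t"
    and h: "holds (mv_reduct S) (split_trm s) (split_trm t)"
  shows "holds S s t"
  unfolding holds_def
proof (intro allI impI)
  fix v :: "nat \<Rightarrow> 'a" assume v: "range v \<subseteq> universe S"
  define w where "w k = (if even k then tau S (v (k div 2)) else v (k div 2))" for k
  have "range w \<subseteq> universe S"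
    using v S by (auto simp: w_def smmv_algebra_def alg_hom_def subset_iff)
  moreover have "w \<circ> flatten_var = (\<lambda>(b, n). if b then tau S (v n) else v n)"
    by (auto simp: fun_eq_iff flatten_var_def w_def)
  then have "trm_value S v r = trm_value (mv_reduct S) w (split_trm r)"
    if "wf_trm smmv_arity r" for r
    using trm_value_split_tau[OF S v that] by (simp add: split_trm_def trm_value_map)
  ultimately show "trm_value S v s = trm_value S v t"
    using h wf by (simp add: holds_def)
qed

text \<open>Together with those of MV-algebras, these identities axiomatise SMMV-algebras; therefore
membership in the generated variety forces the operator to be an idempotent endomorphism.\<close>

lemma smmv_algebraI:
  assumes wf: "wf_alg smmv_arity S" and mv: "mv_algebra (mv_reduct S)"
    and hom: "\<And>f. holds S (Op Tau [Op (MV f) (map Var [0..<mv_arity f])])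
        (Op (MV f) (map (\<lambda>i. Op Tau [Var i]) [0..<mv_arity f]))"
    and idem: "holds S (Op Tau [Op Tau [Var 0]]) (Op Tau [Var 0])"
  shows "smmv_algebra S"
proof -
  have tau_in: "tau S x \<in> universe S" if "x \<in> universe S" for x
    using wf that by (auto simp: wf_alg_def tau_def dest!: spec[of _ Tau])
  have "tau S (interp S (MV f) xs) = interp S (MV f) (map (tau S) xs)"
    if xs: "length xs = mv_arity f" "set xs \<subseteq> universe S" for f xs
  proof -
    obtain x0 where x0: "x0 \<in> universe S" using wf by (auto simp: wf_alg_def)
    define v where "v i = (if i < length xs then xs ! i else x0)" for i
    have v: "range v \<subseteq> universe S" using x0 xs by (auto simp: v_def)
    have "map v [0..<mv_arity f] = xs" using xs by (auto simp: v_def intro: nth_equalityI)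
    moreover have "map (\<lambda>i. tau S (v i)) [0..<mv_arity f] = map (tau S) xs"
      using xs by (auto simp: v_def intro: nth_equalityI)
    moreover have "tau S (interp S (MV f) (map v [0..<mv_arity f])) =
        interp S (MV f) (map (\<lambda>i. tau S (v i)) [0..<mv_arity f])"
      using hom[of f] v by (simp add: holds_def tau_def comp_def)
    ultimately show ?thesis by simp
  qed
  moreover have "tau S (tau S x) = tau S x" if "x \<in> universe S" for x
    using idem that by (auto simp: holds_def tau_def dest!: spec[of _ "\<lambda>_. x"])
  ultimately show ?thesis using mv tau_in by (auto simp: smmv_algebra_def alg_hom_def)
qed

lemma holds_tau_axioms:
  fixes S :: "(smmv_op, 'a) alg"
  assumes S: "smmv_algebra S"
  shows "holds S (Op Tau [Op (MV f) (map Var [0..<mv_arity f])])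
        (Op (MV f) (map (\<lambda>i. Op Tau [Var i]) [0..<mv_arity f]))" (is ?A)
    and "holds S (Op Tau [Op Tau [Var 0]]) (Op Tau [Var 0])" (is ?B)
proof -
  show ?A unfolding holds_def
  proof (intro allI impI)
    fix v :: "nat \<Rightarrow> 'a" assume v: "range v \<subseteq> universe S"
    have "tau S (interp S (MV f) (map v [0..<mv_arity f])) =
        interp S (MV f) (map (tau S) (map v [0..<mv_arity f]))"
    proof -
      have "set (map v [0..<mv_arity f]) \<subseteq> universe S" using v by auto
      moreover have "length (map v [0..<mv_arity f]) = mv_arity f" by simp
      ultimately show ?thesis using S unfolding smmv_algebra_def alg_hom_def mv_reduct_simps by blast
    qed
    then show "trm_value S v (Op Tau [Op (MV f) (map Var [0..<mv_arity f])]) =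
      trm_value S v (Op (MV f) (map (\<lambda>i. Op Tau [Var i]) [0..<mv_arity f]))"
      by (simp add: tau_def comp_def)
  qed
  show ?B using S by (auto simp: holds_def smmv_algebra_def tau_def subset_iff)
qed

text \<open>Being an SMMV-algebra and having a reduct in the variety of \<open>A\<close> are equational
conditions that \<open>D(A)\<close> satisfies. For the converse, splitting the terms turns an identity of
\<open>D(A)\<close> into one of \<open>A\<close>, hence of the reduct of \<open>S\<close>, hence into one of
\<open>S\<close>.\<close>

theorem V_diag_smmv:
  fixes A :: "(mv_op, 'a) alg"
  assumes A: "mv_algebra A"
  shows "(V_SMMV (diag_smmv A) :: (smmv_op, 'u) alg set) = smmv_class (V_MV A)"
proof (rule Set.set_eqI)
  fix S :: "(smmv_op, 'u) alg"
  note D = smmv_algebra_diag[OF A]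
  note iffD = variety_gen_singleton_iff[OF wf_alg_smmv[OF D]]
  note iffA = variety_gen_singleton_iff[OF mv_algebra_wf[OF A]]
  show "S \<in> V_SMMV (diag_smmv A) \<longleftrightarrow> S \<in> smmv_class (V_MV A)"
  proof
    assume "S \<in> V_SMMV (diag_smmv A)"
    then have wf: "wf_alg smmv_arity S"
      and h: "\<And>s t. wf_trm smmv_arity s \<Longrightarrow> wf_trm smmv_arity t \<Longrightarrow> holds (diag_smmv A) s t \<Longrightarrow> holds S s t"
      unfolding iffD by auto
    have wf_red: "wf_alg mv_arity (mv_reduct S)"
      unfolding wf_alg_def
    proof (intro conjI allI impI)
      show "universe (mv_reduct S) \<noteq> {}" using wf by (simp add: wf_alg_def)
      fix f xs assume "length xs = mv_arity f \<and> set xs \<subseteq> universe (mv_reduct S)"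
      then show "interp (mv_reduct S) f xs \<in> universe (mv_reduct S)"
        using wf[unfolded wf_alg_def, THEN conjunct2, rule_format, of xs "MV f"] by simp
    qed
    \<comment> \<open>MV-identities are inherited by the square of \<open>A\<close>, which is the reduct of \<open>D(A)\<close>.\<close>
    have red: "mv_reduct S \<in> V_MV A"
      unfolding iffA
    proof (intro conjI allI impI wf_red)
      fix s t :: "(mv_op, nat) trm"
      assume st: "wf_trm mv_arity s \<and> wf_trm mv_arity t \<and> holds A s t"
      have "holds (diag_smmv A) (map_trm MV id s) (map_trm MV id t)"
        unfolding holds_def
      proof (intro allI impI)
        fix v :: "nat \<Rightarrow> 'a \<times> 'a" assume v: "range v \<subseteq> universe (diag_smmv A)"
        then have "range (fst \<circ> v) \<subseteq> universe A" "range (snd \<circ> v) \<subseteq> universe A"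
          by (simp_all add: image_subset_iff mem_Times_iff)
        with st show "trm_value (diag_smmv A) v (map_trm MV id s) =
            trm_value (diag_smmv A) v (map_trm MV id t)"
          by (simp add: trm_value_embed_mv trm_value_square_mv holds_def)
      qed
      then have "holds S (map_trm MV id s) (map_trm MV id t)"
        using h st wf_embed_mv by blast
      then show "holds (mv_reduct S) s t"
        by (simp add: holds_def trm_value_embed_mv)
    qed
    then have "mv_algebra (mv_reduct S)" using A mv_algebra_in_variety by blast
    moreover have "holds S (Op Tau [Op (MV f) (map Var [0..<mv_arity f])])
        (Op (MV f) (map (\<lambda>i. Op Tau [Var i]) [0..<mv_arity f]))" for f
      by (rule h) (use holds_tau_axioms(1)[OF D] in auto)
    moreover have "holds S (Op Tau [Op Tau [Var 0]]) (Op Tau [Var 0])"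
      by (rule h) (use holds_tau_axioms(2)[OF D] in auto)
    ultimately have "smmv_algebra S" by (intro smmv_algebraI wf)
    with red show "S \<in> smmv_class (V_MV A)" by (simp add: smmv_class_def)
  next
    assume "S \<in> smmv_class (V_MV A)"
    then have S: "smmv_algebra S" and red: "mv_reduct S \<in> V_MV A" by (auto simp: smmv_class_def)
    show "S \<in> V_SMMV (diag_smmv A)"
      unfolding iffD
    proof (intro conjI allI impI wf_alg_smmv[OF S])
      fix s t assume st: "wf_trm smmv_arity s \<and> wf_trm smmv_arity t \<and> holds (diag_smmv A) s t"
      then have "holds A (split_trm s) (split_trm t)" by (intro holds_split_trm[OF A]) auto
      moreover have "wf_trm mv_arity (split_trm s)" "wf_trm mv_arity (split_trm t)"
        using st by (auto simp: split_trm_def wf_trm_map wf_split_tau)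
      ultimately have "holds (mv_reduct S) (split_trm s) (split_trm t)"
        using red unfolding iffA by blast
      then show "holds S s t" using S st by (intro holds_of_split_trm) auto
    qed
  qed
qed

text \<open>The identity operator makes every member of a variety of MV-algebras visible among the
SMMV-algebras over it.\<close>

lemma mk_smmv_id_in_smmv_class_iff:
  assumes "mv_algebra M"
  shows "mk_smmv M id \<in> smmv_class \<V> \<longleftrightarrow> M \<in> \<V>"
proof -
  have "mv_reduct (mk_smmv M id) = M" by (simp add: mv_reduct_def mk_smmv_def)
  moreover have "tau (mk_smmv M id) = id" by (auto simp: tau_def mk_smmv_def)
  ultimately show ?thesis using assms
    by (auto simp: smmv_class_def smmv_algebra_def alg_hom_def)
qed

theorem V_diag_smmv_eq_iff:
  fixes A :: "(mv_op, 'a) alg" and B :: "(mv_op, 'b) alg"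
  assumes A: "mv_algebra A" and B: "mv_algebra B"
  shows "(V_SMMV (diag_smmv A) :: (smmv_op, 'u) alg set) = V_SMMV (diag_smmv B)
     \<longleftrightarrow> (V_MV A :: (mv_op, 'u) alg set) = V_MV B"
proof
  assume "(V_SMMV (diag_smmv A) :: (smmv_op, 'u) alg set) = V_SMMV (diag_smmv B)"
  then have eq: "(smmv_class (V_MV A) :: (smmv_op, 'u) alg set) = smmv_class (V_MV B)"
    by (simp add: V_diag_smmv A B)
  show "(V_MV A :: (mv_op, 'u) alg set) = V_MV B"
    using eq mk_smmv_id_in_smmv_class_iff mv_algebra_in_variety[OF A] mv_algebra_in_variety[OF B]
    by blast
qed (simp add: V_diag_smmv A B)

section \<open>Order and arithmetic in MV-algebras\<close>

locale mv_alg =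
  fixes A :: "(mv_op, 'a) alg"
  assumes mv: "mv_algebra A"
begin

abbreviation U where "U \<equiv> universe A"
abbreviation mv_plus (infixl "\<oplus>" 65) where "x \<oplus> y \<equiv> oplus A x y"
abbreviation mv_neg ("\<sim> _" [81] 80) where "\<sim> x \<equiv> neg A x"
abbreviation mv_zero ("\<^bold>0") where "\<^bold>0 \<equiv> zero A"
abbreviation mv_one ("\<^bold>1") where "\<^bold>1 \<equiv> one A"

text \<open>In \<open>[0,1]\<close> this is truncated subtraction.\<close>

definition diff (infixl "\<ominus>" 65) where "x \<ominus> y = \<sim> (\<sim> x \<oplus> y)"
definition le (infix "\<preceq>" 50) where "x \<preceq> y \<longleftrightarrow> \<sim> x \<oplus> y = \<^bold>1"

lemma closed [simp, intro]:
  "x \<in> U \<Longrightarrow> y \<in> U \<Longrightarrow> x \<oplus> y \<in> U" "x \<in> U \<Longrightarrow> \<sim> x \<in> U" "\<^bold>0 \<in> U" "\<^bold>1 \<in> U"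
  "x \<in> U \<Longrightarrow> y \<in> U \<Longrightarrow> x \<ominus> y \<in> U"
proof -
  have wf: "wf_alg mv_arity A" using mv by (rule mv_algebra_wf)
  show o: "x \<oplus> y \<in> U" if "x \<in> U" "y \<in> U" for x y
    using wf that by (auto simp: wf_alg_def oplus_def dest!: spec[of _ Oplus])
  show n: "\<sim> x \<in> U" if "x \<in> U" for x
    using wf that by (auto simp: wf_alg_def neg_def dest!: spec[of _ Neg])
  show z: "\<^bold>0 \<in> U"
    using wf by (auto simp: wf_alg_def zero_def dest!: spec[of _ Zero])
  show "\<^bold>1 \<in> U" using n[OF z] by (simp add: one_def)
  show "x \<in> U \<Longrightarrow> y \<in> U \<Longrightarrow> x \<ominus> y \<in> U" using o n by (simp add: diff_def)
qed

lemma assoc: "x \<in> U \<Longrightarrow> y \<in> U \<Longrightarrow> z \<in> U \<Longrightarrow> x \<oplus> y \<oplus> z = x \<oplus> (y \<oplus> z)"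
  and comm: "x \<in> U \<Longrightarrow> y \<in> U \<Longrightarrow> x \<oplus> y = y \<oplus> x"
  and plus_zero [simp]: "x \<in> U \<Longrightarrow> x \<oplus> \<^bold>0 = x"
  and neg_neg [simp]: "x \<in> U \<Longrightarrow> \<sim> (\<sim> x) = x"
  and plus_one [simp]: "x \<in> U \<Longrightarrow> x \<oplus> \<^bold>1 = \<^bold>1"
  and luk: "x \<in> U \<Longrightarrow> y \<in> U \<Longrightarrow> \<sim> (\<sim> x \<oplus> y) \<oplus> y = \<sim> (\<sim> y \<oplus> x) \<oplus> x"
  using mv unfolding mv_algebra_def imp_def by auto

lemma lcomm: "x \<in> U \<Longrightarrow> y \<in> U \<Longrightarrow> z \<in> U \<Longrightarrow> x \<oplus> (y \<oplus> z) = y \<oplus> (x \<oplus> z)"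
  by (metis assoc comm)

lemmas ac = assoc comm lcomm

lemma neg_zero [simp]: "\<sim> \<^bold>0 = \<^bold>1" by (simp add: one_def)
lemma neg_one [simp]: "\<sim> \<^bold>1 = \<^bold>0" using neg_neg[of "zero A"] by simp
lemma zero_plus [simp]: "x \<in> U \<Longrightarrow> \<^bold>0 \<oplus> x = x" by (simp add: comm[of "zero A"])
lemma one_plus [simp]: "x \<in> U \<Longrightarrow> \<^bold>1 \<oplus> x = \<^bold>1" by (simp add: comm[of "one A"])

lemma neg_plus [simp]: "x \<in> U \<Longrightarrow> \<sim> x \<oplus> x = \<^bold>1"
  using luk[of "one A" x] by simp

lemma plus_neg [simp]: "x \<in> U \<Longrightarrow> x \<oplus> \<sim> x = \<^bold>1"
  by (simp add: comm[of x])

lemma neg_inj: "x \<in> U \<Longrightarrow> y \<in> U \<Longrightarrow> \<sim> x = \<sim> y \<Longrightarrow> x = y"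
  by (metis neg_neg)

text \<open>Both sides are the join of \<open>x\<close> and \<open>y\<close>; this is the axiom peculiar to
MV-algebras.\<close>

lemma diff_plus: "x \<in> U \<Longrightarrow> y \<in> U \<Longrightarrow> (x \<ominus> y) \<oplus> y = (y \<ominus> x) \<oplus> x"
  by (simp add: diff_def luk)

lemma diff_eq_zero_iff: "x \<in> U \<Longrightarrow> y \<in> U \<Longrightarrow> x \<ominus> y = \<^bold>0 \<longleftrightarrow> x \<preceq> y"
  unfolding diff_def le_def by (metis closed(1,2,3) neg_neg neg_one neg_zero)

lemma le_diff_plus: "x \<in> U \<Longrightarrow> y \<in> U \<Longrightarrow> x \<preceq> y \<Longrightarrow> (y \<ominus> x) \<oplus> x = y"
  by (simp add: diff_plus[of y x] diff_eq_zero_iff[THEN iffD2])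

lemma le_plus: "x \<in> U \<Longrightarrow> y \<in> U \<Longrightarrow> x \<preceq> x \<oplus> y"
  by (simp add: le_def flip: assoc)

lemma le_plus2: "x \<in> U \<Longrightarrow> y \<in> U \<Longrightarrow> x \<preceq> y \<oplus> x"
  by (simp add: comm[of y] le_plus)

text \<open>The order is the algebraic preorder of the monoid, which makes transitivity and monotonicity of
\<open>\<oplus>\<close> immediate.\<close>

lemma le_iff: "x \<in> U \<Longrightarrow> y \<in> U \<Longrightarrow> x \<preceq> y \<longleftrightarrow> (\<exists>z\<in>U. y = z \<oplus> x)"
  using le_diff_plus le_plus2 by (metis closed(5))

lemma le_refl [simp]: "x \<in> U \<Longrightarrow> x \<preceq> x" by (simp add: le_def)
lemma zero_le [simp]: "x \<in> U \<Longrightarrow> \<^bold>0 \<preceq> x" by (simp add: le_def)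
lemma le_one [simp]: "x \<in> U \<Longrightarrow> x \<preceq> \<^bold>1" by (simp add: le_def)

lemma le_antisym: "x \<in> U \<Longrightarrow> y \<in> U \<Longrightarrow> x \<preceq> y \<Longrightarrow> y \<preceq> x \<Longrightarrow> x = y"
  using le_diff_plus[of x y] diff_eq_zero_iff[of y x] by simp

lemma le_trans:
  assumes "x \<preceq> y" "y \<preceq> z" "x \<in> U" "y \<in> U" "z \<in> U"
  shows "x \<preceq> z"
proof -
  obtain c d where "c \<in> U" "y = c \<oplus> x" "d \<in> U" "z = d \<oplus> y"
    using assms le_iff by metis
  then show ?thesis using assms le_iff[of x z] by (auto simp flip: assoc)
qed

lemma le_zero: "x \<in> U \<Longrightarrow> x \<preceq> \<^bold>0 \<Longrightarrow> x = \<^bold>0" using le_antisym[of x "zero A"] by simp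

lemma neg_le: "x \<in> U \<Longrightarrow> y \<in> U \<Longrightarrow> \<sim> x \<preceq> \<sim> y \<longleftrightarrow> y \<preceq> x"
  by (simp add: le_def comm)

lemma plus_mono:
  assumes "x \<preceq> y" "x \<in> U" "y \<in> U" "z \<in> U"
  shows "x \<oplus> z \<preceq> y \<oplus> z"
proof -
  obtain c where "c \<in> U" "y = c \<oplus> x" using assms le_iff by metis
  then show ?thesis using assms le_iff[of "x \<oplus> z" "y \<oplus> z"] by (auto simp: assoc)
qed

text \<open>Truncated subtraction is residuated with addition, so inequalities can be moved across it.\<close>

lemma diff_le_iff: "x \<in> U \<Longrightarrow> y \<in> U \<Longrightarrow> z \<in> U \<Longrightarrow> x \<ominus> y \<preceq> z \<longleftrightarrow> x \<preceq> z \<oplus> y"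
  by (simp add: diff_def le_def assoc comm[of y z])

lemma diff_le: "x \<in> U \<Longrightarrow> y \<in> U \<Longrightarrow> x \<ominus> y \<preceq> x"
  by (simp add: diff_le_iff le_plus)

lemma diff_le_neg: "x \<in> U \<Longrightarrow> y \<in> U \<Longrightarrow> x \<ominus> y \<preceq> \<sim> y"
  by (simp add: diff_le_iff)

lemma diff_mono: "x \<preceq> y \<Longrightarrow> x \<in> U \<Longrightarrow> y \<in> U \<Longrightarrow> z \<in> U \<Longrightarrow> x \<ominus> z \<preceq> y \<ominus> z"
  by (simp add: diff_def neg_le) (simp add: neg_le plus_mono)

lemma plus_diff_cancel:
  assumes "x \<in> U" "y \<in> U" "x \<preceq> \<sim> y"
  shows "(x \<oplus> y) \<ominus> y = x"
  using assms luk[of "\<sim> x" y] le_diff_plus[of y "\<sim> x"] neg_le[of "\<sim> x" y]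
  by (simp add: diff_def comm)

text \<open>By \<open>le_diff_plus\<close>, adding \<open>x\<close> back to \<open>z \<ominus> x\<close>
gives \<open>z\<close>.\<close>

lemma join_least:
  assumes "x \<preceq> z" "y \<preceq> z" "x \<in> U" "y \<in> U" "z \<in> U"
  shows "(y \<ominus> x) \<oplus> x \<preceq> z"
  using plus_mono[OF diff_mono[of y z x], of x] assms by (simp add: le_diff_plus)

lemma diff_neg: "x \<in> U \<Longrightarrow> y \<in> U \<Longrightarrow> \<sim> x \<ominus> \<sim> y = y \<ominus> x"
  by (simp add: diff_def comm)

text \<open>De Morgan duality between meet and join, which transfers the results about joins.\<close>

lemma meet_eq: "x \<in> U \<Longrightarrow> y \<in> U \<Longrightarrow> x \<ominus> (x \<ominus> y) = \<sim> ((\<sim> y \<ominus> \<sim> x) \<oplus> \<sim> x)"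
  by (simp add: diff_neg) (simp add: diff_def comm)

lemma meet_comm: "x \<in> U \<Longrightarrow> y \<in> U \<Longrightarrow> x \<ominus> (x \<ominus> y) = y \<ominus> (y \<ominus> x)"
  by (simp add: meet_eq diff_plus[of "\<sim> y" "\<sim> x"])

lemma meet_greatest:
  assumes "z \<preceq> x" "z \<preceq> y" "x \<in> U" "y \<in> U" "z \<in> U"
  shows "z \<preceq> x \<ominus> (x \<ominus> y)"
  using join_least[of "\<sim> x" "\<sim> z" "\<sim> y"] assms neg_le[of "\<sim> z" "(\<sim> y \<ominus> \<sim> x) \<oplus> \<sim> x"]
  by (simp add: meet_eq neg_le)

text \<open>The source of linearity of prime quotients: let \<open>m\<close> be the meet of \<open>x\<close>
and \<open>y\<close>. Adding a common lower bound \<open>z\<close> of the two differences to \<open>m\<close>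
stays below \<open>x\<close> and below \<open>y\<close>, hence below \<open>m\<close>, and \<open>z\<close>
can be cancelled.\<close>

lemma orthogonal_diffs:
  assumes "z \<preceq> x \<ominus> y" "z \<preceq> y \<ominus> x" "x \<in> U" "y \<in> U" "z \<in> U"
  shows "z = \<^bold>0"
proof -
  define m where "m = x \<ominus> (x \<ominus> y)"
  have m: "m \<in> U" "m = y \<ominus> (y \<ominus> x)" using assms by (simp_all add: m_def meet_comm)
  have "m \<oplus> (x \<ominus> y) = x" using assms by (simp add: m_def le_diff_plus diff_le)
  then have "z \<oplus> m \<preceq> x" using plus_mono[OF assms(1), of m] assms m(1) by (simp add: comm)
  moreover have "m \<oplus> (y \<ominus> x) = y" using assms by (simp add: m(2) le_diff_plus diff_le)
  then have "z \<oplus> m \<preceq> y" using plus_mono[OF assms(2), of m] assms m(1) by (simp add: comm)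
  ultimately have "z \<oplus> m \<preceq> m" using meet_greatest assms m(1) by (simp add: m_def)
  moreover have "m \<preceq> y" using assms by (simp add: m(2) diff_le)
  then have "\<sim> y \<preceq> \<sim> m" using assms m(1) by (simp add: neg_le)
  then have "z \<preceq> \<sim> m"
    using le_trans[OF assms(1) diff_le_neg] le_trans[of z "\<sim> y" "\<sim> m"] assms m(1) by simp
  then have "(z \<oplus> m) \<ominus> m = z" using assms m(1) by (simp add: plus_diff_cancel)
  ultimately show ?thesis using assms m(1) diff_eq_zero_iff[of "z \<oplus> m" m] by simp
qed

end

section \<open>Prime ideals and quotient chains\<close>

context mv_alg begin

text \<open>By residuation \<open>t \<ominus> p\<close> is a common lower bound of \<open>c\<close> and
\<open>d\<close>.\<close>

lemma le_plus_of_orthogonal: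
  assumes orth: "\<And>s. s \<in> U \<Longrightarrow> s \<preceq> c \<Longrightarrow> s \<preceq> d \<Longrightarrow> s = \<^bold>0"
    and "t \<preceq> c \<oplus> p" "t \<preceq> d \<oplus> p" "c \<in> U" "d \<in> U" "p \<in> U" "t \<in> U"
  shows "t \<preceq> p"
proof -
  have "t \<ominus> p = \<^bold>0" by (rule orth) (use assms in \<open>simp_all add: diff_le_iff\<close>)
  then show ?thesis using assms by (simp add: diff_eq_zero_iff)
qed

primrec multiple :: "nat \<Rightarrow> 'a \<Rightarrow> 'a" where
  "multiple 0 x = \<^bold>0"
| "multiple (Suc n) x = x \<oplus> multiple n x"

lemma multiple_closed [simp]: "x \<in> U \<Longrightarrow> multiple n x \<in> U"
  by (induction n) auto

lemma multiple_add: "x \<in> U \<Longrightarrow> multiple (m + n) x = multiple m x \<oplus> multiple n x"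
  by (induction m) (auto simp: assoc)

text \<open>One summand \<open>c\<close> or \<open>d\<close> is removed at a time with
\<open>le_plus_of_orthogonal\<close>, all other summands being counted towards \<open>p\<close>: first the
copies of \<open>c\<close> against a single \<open>d\<close>, then the copies of \<open>d\<close>.\<close>

lemma le_of_orthogonal_multiples:
  assumes orth: "\<And>s. s \<in> U \<Longrightarrow> s \<preceq> c \<Longrightarrow> s \<preceq> d \<Longrightarrow> s = \<^bold>0"
    and U: "c \<in> U" "d \<in> U" "t \<in> U" "p \<in> U"
    and t: "t \<preceq> multiple m c \<oplus> p" "t \<preceq> multiple n d \<oplus> p"
  shows "t \<preceq> p"
proof -
  have one: "t \<preceq> p" if "t \<preceq> multiple m c \<oplus> p" "t \<preceq> d \<oplus> p" "p \<in> U" for p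
    using that(1)
  proof (induction m)
    case (Suc m)
    have c: "t \<preceq> c \<oplus> (multiple m c \<oplus> p)" using Suc.prems U that by (simp add: assoc)
    have "d \<oplus> p \<preceq> multiple m c \<oplus> (d \<oplus> p)" using U that by (simp add: le_plus2)
    then have d: "t \<preceq> d \<oplus> (multiple m c \<oplus> p)"
      using le_trans[OF that(2), of "multiple m c \<oplus> (d \<oplus> p)"] U that by (simp add: lcomm)
    have "t \<preceq> multiple m c \<oplus> p"
      by (rule le_plus_of_orthogonal[OF orth c d]) (use U that in simp_all)
    then show ?case by (rule Suc.IH)
  qed (use that in simp)
  show ?thesis using t(2)
  proof (induction n)
    case (Suc n)
    have "multiple m c \<oplus> p \<preceq> multiple n d \<oplus> (multiple m c \<oplus> p)" using U by (simp add: le_plus2)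
    then have "t \<preceq> multiple m c \<oplus> (multiple n d \<oplus> p)"
      using le_trans[OF t(1), of "multiple n d \<oplus> (multiple m c \<oplus> p)"] U by (simp add: lcomm)
    moreover have "t \<preceq> d \<oplus> (multiple n d \<oplus> p)" using Suc.prems U by (simp add: assoc)
    ultimately have "t \<preceq> multiple n d \<oplus> p" by (rule one) (use U in simp)
    then show ?case by (rule Suc.IH)
  qed (use U in simp)
qed

definition is_ideal :: "'a set \<Rightarrow> bool" where
  "is_ideal I \<longleftrightarrow> I \<subseteq> U \<and> \<^bold>0 \<in> I \<and> (\<forall>x\<in>I. \<forall>y\<in>I. x \<oplus> y \<in> I) \<and>
     (\<forall>x\<in>I. \<forall>y\<in>U. y \<preceq> x \<longrightarrow> y \<in> I)"

lemma is_idealD: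
  assumes "is_ideal I"
  shows "x \<in> I \<Longrightarrow> x \<in> U" "\<^bold>0 \<in> I" "x \<in> I \<Longrightarrow> y \<in> I \<Longrightarrow> x \<oplus> y \<in> I"
    "x \<in> I \<Longrightarrow> y \<in> U \<Longrightarrow> y \<preceq> x \<Longrightarrow> y \<in> I"
  using assms unfolding is_ideal_def by blast+

definition adjoin :: "'a set \<Rightarrow> 'a \<Rightarrow> 'a set" where
  "adjoin I c = {z \<in> U. \<exists>p\<in>I. \<exists>n. z \<preceq> multiple n c \<oplus> p}"

lemma adjoin_ideal:
  assumes I: "is_ideal I" and c: "c \<in> U"
  shows "is_ideal (adjoin I c)" "I \<subseteq> adjoin I c" "c \<in> adjoin I c"
proof -
  note D = is_idealD[OF I]
  show "I \<subseteq> adjoin I c"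
    using D(1) by (auto simp: adjoin_def intro!: bexI exI[of _ 0])
  show "c \<in> adjoin I c"
    using D(2) c by (auto simp: adjoin_def intro!: bexI[of _ "zero A"] exI[of _ 1])
  have add: "x \<oplus> y \<in> adjoin I c" if xy: "x \<in> adjoin I c" "y \<in> adjoin I c" for x y
  proof -
    obtain p m where p: "p \<in> I" "x \<preceq> multiple m c \<oplus> p" using xy by (auto simp: adjoin_def)
    obtain q n where q: "q \<in> I" "y \<preceq> multiple n c \<oplus> q" using xy by (auto simp: adjoin_def)
    have U: "x \<in> U" "y \<in> U" "p \<in> U" "q \<in> U" using xy p q D(1) by (auto simp: adjoin_def)
    have "x \<oplus> y \<preceq> multiple m c \<oplus> p \<oplus> y" using plus_mono[OF p(2)] U c by simp
    moreover have "y \<oplus> (multiple m c \<oplus> p) \<preceq> multiple n c \<oplus> q \<oplus> (multiple m c \<oplus> p)"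
      using plus_mono[OF q(2)] U c by simp
    ultimately have "x \<oplus> y \<preceq> multiple n c \<oplus> q \<oplus> (multiple m c \<oplus> p)"
      using le_trans[of "x \<oplus> y" "multiple m c \<oplus> p \<oplus> y" "multiple n c \<oplus> q \<oplus> (multiple m c \<oplus> p)"] U c
      by (simp add: comm[of y])
    also have "multiple n c \<oplus> q \<oplus> (multiple m c \<oplus> p) = multiple (m + n) c \<oplus> (p \<oplus> q)"
      using U c by (simp add: multiple_add ac)
    finally show ?thesis using U p(1) q(1) D(3) by (auto simp: adjoin_def)
  qed
  have down: "y \<in> adjoin I c" if h: "x \<in> adjoin I c" "y \<in> U" "y \<preceq> x" for x y
  proof -
    obtain p n where p: "p \<in> I" "x \<preceq> multiple n c \<oplus> p" using h by (auto simp: adjoin_def)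
    have "x \<in> U" "p \<in> U" using h p D(1) by (auto simp: adjoin_def)
    then have "y \<preceq> multiple n c \<oplus> p" using le_trans[OF h(3) p(2)] h c by simp
    then show ?thesis using h p by (auto simp: adjoin_def)
  qed
  show "is_ideal (adjoin I c)"
    unfolding is_ideal_def using add down \<open>I \<subseteq> adjoin I c\<close> D(2) by (auto simp: adjoin_def)
qed

text \<open>An ideal \<open>I\<close> that is maximal among those avoiding \<open>x\<close> is prime. If it
contained neither \<open>a \<ominus> b\<close> nor \<open>b \<ominus> a\<close>, then \<open>x\<close>
would lie in both ideals obtained by adjoining one of them, hence, as these differences are orthogonal, in
\<open>I\<close>.\<close>

theorem prime_ideal_avoiding:
  assumes x: "x \<in> U" "x \<noteq> \<^bold>0"
  shows "\<exists>I. is_ideal I \<and> x \<notin> I \<and> (\<forall>a\<in>U. \<forall>b\<in>U. a \<ominus> b \<in> I \<or> b \<ominus> a \<in> I)"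
proof -
  define \<I> where "\<I> = {I. is_ideal I \<and> x \<notin> I}"
  have "is_ideal {\<^bold>0}" unfolding is_ideal_def using le_zero by auto
  then have "{\<^bold>0} \<in> \<I>" using x by (simp add: \<I>_def)
  moreover have "\<Union>\<C> \<in> \<I>" if "\<C> \<noteq> {}" "subset.chain \<I> \<C>" for \<C>
  proof -
    have C: "is_ideal I" "x \<notin> I" if "I \<in> \<C>" for I
      using that \<open>subset.chain \<I> \<C>\<close> by (auto simp: \<I>_def subset_chain_def)
    have "a \<oplus> b \<in> \<Union>\<C>" if "I \<in> \<C>" "J \<in> \<C>" "a \<in> I" "b \<in> J" for a b I J
    proof -
      have "I \<subseteq> J \<or> J \<subseteq> I" using that(1,2) \<open>subset.chain \<I> \<C>\<close> by (auto simp: subset_chain_def)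
      then show ?thesis using that C is_idealD(3) by blast
    qed
    then have "\<forall>a\<in>\<Union>\<C>. \<forall>b\<in>\<Union>\<C>. a \<oplus> b \<in> \<Union>\<C>" by blast
    moreover have "\<Union>\<C> \<subseteq> U" using is_idealD(1)[OF C(1)] by blast
    moreover have "\<^bold>0 \<in> \<Union>\<C>" using \<open>\<C> \<noteq> {}\<close> is_idealD(2)[OF C(1)] by blast
    moreover have "\<forall>a\<in>\<Union>\<C>. \<forall>b\<in>U. b \<preceq> a \<longrightarrow> b \<in> \<Union>\<C>" using is_idealD(4)[OF C(1)] by blast
    ultimately have "is_ideal (\<Union>\<C>)" unfolding is_ideal_def by blast
    then show ?thesis using C(2) by (auto simp: \<I>_def)
  qed
  ultimately obtain I where I: "I \<in> \<I>" "\<And>J. J \<in> \<I> \<Longrightarrow> I \<subseteq> J \<Longrightarrow> J = I"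
    using subset_Zorn_nonempty[of \<I>] by blast
  then have ideal: "is_ideal I" "x \<notin> I" by (auto simp: \<I>_def)
  note D = is_idealD[OF ideal(1)]
  have "a \<ominus> b \<in> I \<or> b \<ominus> a \<in> I" if ab: "a \<in> U" "b \<in> U" for a b
  proof (rule ccontr)
    assume neg: "\<not> ?thesis"
    have ex: "x \<in> adjoin I c" if c: "c \<in> U" "c \<notin> I" for c
      using I(2)[of "adjoin I c"] adjoin_ideal[OF ideal(1) c(1)] c(2) by (auto simp: \<I>_def)
    obtain p m where p: "p \<in> I" "x \<preceq> multiple m (a \<ominus> b) \<oplus> p"
      using ex[of "a \<ominus> b"] neg ab by (auto simp: adjoin_def)
    obtain q n where q: "q \<in> I" "x \<preceq> multiple n (b \<ominus> a) \<oplus> q"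
      using ex[of "b \<ominus> a"] neg ab by (auto simp: adjoin_def)
    have U: "p \<in> U" "q \<in> U" using p q D(1) by auto
    have "multiple m (a \<ominus> b) \<oplus> p \<preceq> multiple m (a \<ominus> b) \<oplus> (p \<oplus> q)"
      using U ab by (simp add: le_plus flip: assoc)
    then have 1: "x \<preceq> multiple m (a \<ominus> b) \<oplus> (p \<oplus> q)"
      by (rule le_trans[OF p(2)]) (use U ab x in simp_all)
    have "multiple n (b \<ominus> a) \<oplus> q \<preceq> multiple n (b \<ominus> a) \<oplus> (p \<oplus> q)"
      using U ab by (simp add: le_plus comm[of p] flip: assoc)
    then have 2: "x \<preceq> multiple n (b \<ominus> a) \<oplus> (p \<oplus> q)"
      by (rule le_trans[OF q(2)]) (use U ab x in simp_all)
    have orth: "s = \<^bold>0" if "s \<in> U" "s \<preceq> a \<ominus> b" "s \<preceq> b \<ominus> a" for s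
      using orthogonal_diffs[OF that(2,3)] that ab by simp
    have "x \<preceq> p \<oplus> q"
      by (rule le_of_orthogonal_multiples[OF orth _ _ _ _ 1 2]) (use U ab x in simp_all)
    then have "x \<in> I" using D(3,4) p(1) q(1) x by blast
    then show False using ideal by blast
  qed
  then show ?thesis using ideal by blast
qed

definition coset :: "'a set \<Rightarrow> 'a \<Rightarrow> 'a set" where
  "coset I x = {y \<in> U. x \<ominus> y \<in> I \<and> y \<ominus> x \<in> I}"

text \<open>The operations are computed on representatives; \<open>quotient_simps\<close> shows that the
choice is immaterial.\<close>

definition quotient :: "'a set \<Rightarrow> (mv_op, 'a set) alg" where
  "quotient I = \<lparr>universe = coset I ` U,
     interp = (\<lambda>f Xs. coset I (interp A f (map (\<lambda>X. SOME x. x \<in> X) Xs)))\<rparr>"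

lemma diff_triangle:
  assumes "x \<in> U" "y \<in> U" "z \<in> U"
  shows "x \<ominus> z \<preceq> (x \<ominus> y) \<oplus> (y \<ominus> z)"
proof -
  have "x \<preceq> (x \<ominus> y) \<oplus> y" using assms by (simp flip: diff_le_iff)
  moreover have "y \<preceq> (y \<ominus> z) \<oplus> z" using assms by (simp flip: diff_le_iff)
  then have "y \<oplus> (x \<ominus> y) \<preceq> (y \<ominus> z) \<oplus> z \<oplus> (x \<ominus> y)" using assms by (intro plus_mono) simp_all
  ultimately have "x \<preceq> (y \<ominus> z) \<oplus> z \<oplus> (x \<ominus> y)"
    using le_trans[of x "(x \<ominus> y) \<oplus> y" "(y \<ominus> z) \<oplus> z \<oplus> (x \<ominus> y)"] assms by (simp add: comm[of y])
  then show ?thesis using assms by (simp add: diff_le_iff ac)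
qed

text \<open>Addition respects the congruence of an ideal because of this inequality.\<close>

lemma diff_plus_le:
  assumes "x \<in> U" "y \<in> U" "x' \<in> U" "y' \<in> U"
  shows "(x \<oplus> y) \<ominus> (x' \<oplus> y') \<preceq> (x \<ominus> x') \<oplus> (y \<ominus> y')"
proof -
  have "x \<preceq> (x \<ominus> x') \<oplus> x'" using assms by (simp flip: diff_le_iff)
  then have 1: "x \<oplus> y \<preceq> (x \<ominus> x') \<oplus> x' \<oplus> y" using assms by (intro plus_mono) simp_all
  have "y \<preceq> (y \<ominus> y') \<oplus> y'" using assms by (simp flip: diff_le_iff)
  then have "y \<oplus> ((x \<ominus> x') \<oplus> x') \<preceq> (y \<ominus> y') \<oplus> y' \<oplus> ((x \<ominus> x') \<oplus> x')"
    using assms by (intro plus_mono) simp_all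
  then have "x \<oplus> y \<preceq> (y \<ominus> y') \<oplus> y' \<oplus> ((x \<ominus> x') \<oplus> x')"
    using le_trans[OF 1, of "(y \<ominus> y') \<oplus> y' \<oplus> ((x \<ominus> x') \<oplus> x')"] assms by (simp add: comm[of y])
  also have "(y \<ominus> y') \<oplus> y' \<oplus> ((x \<ominus> x') \<oplus> x') = (x \<ominus> x') \<oplus> (y \<ominus> y') \<oplus> (x' \<oplus> y')"
    using assms by (simp add: ac)
  finally show ?thesis using assms by (simp add: diff_le_iff)
qed

lemma coset_eq_iff:
  assumes I: "is_ideal I" and U: "x \<in> U" "y \<in> U"
  shows "coset I x = coset I y \<longleftrightarrow> x \<ominus> y \<in> I \<and> y \<ominus> x \<in> I"
proof
  note D = is_idealD[OF I]
  have refl: "z \<ominus> z = \<^bold>0" if "z \<in> U" for z using that diff_eq_zero_iff by simp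
  { assume "coset I x = coset I y"
    moreover have "y \<in> coset I y" using U D(2) by (simp add: coset_def refl)
    ultimately show "x \<ominus> y \<in> I \<and> y \<ominus> x \<in> I" by (auto simp: coset_def) }
  have tr: "a \<ominus> c \<in> I" if "a \<ominus> b \<in> I" "b \<ominus> c \<in> I" "a \<in> U" "b \<in> U" "c \<in> U" for a b c
    using D(4)[OF D(3)[OF that(1,2)]] that diff_triangle by simp
  assume "x \<ominus> y \<in> I \<and> y \<ominus> x \<in> I"
  then show "coset I x = coset I y"
    unfolding coset_def using tr U by blast
qed

lemma quotient_simps:
  assumes I: "is_ideal I"
  shows "universe (quotient I) = coset I ` U"
    and "x \<in> U \<Longrightarrow> y \<in> U \<Longrightarrow> oplus (quotient I) (coset I x) (coset I y) = coset I (x \<oplus> y)"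
    and "x \<in> U \<Longrightarrow> neg (quotient I) (coset I x) = coset I (\<sim> x)"
    and "zero (quotient I) = coset I \<^bold>0"
    and "one (quotient I) = coset I \<^bold>1"
proof -
  note D = is_idealD[OF I]
  define r where "r X = (SOME x. x \<in> X)" for X :: "'a set"
  have r: "r (coset I x) \<in> U \<and> x \<ominus> r (coset I x) \<in> I \<and> r (coset I x) \<ominus> x \<in> I" if "x \<in> U" for x
  proof -
    have "x \<in> coset I x" using that D(2) diff_eq_zero_iff[of x x] by (simp add: coset_def)
    then have "r (coset I x) \<in> coset I x" unfolding r_def by (rule someI)
    then show ?thesis by (simp add: coset_def)
  qed
  show "universe (quotient I) = coset I ` U" by (simp add: quotient_def)
  show "oplus (quotient I) (coset I x) (coset I y) = coset I (x \<oplus> y)" if "x \<in> U" "y \<in> U"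
  proof -
    let ?x = "r (coset I x)" and ?y = "r (coset I y)"
    have U: "?x \<in> U" "?y \<in> U" using r that by auto
    have "(?x \<oplus> ?y) \<ominus> (x \<oplus> y) \<in> I"
      by (rule D(4)[OF D(3) _ diff_plus_le]) (use r that U in simp_all)
    moreover have "(x \<oplus> y) \<ominus> (?x \<oplus> ?y) \<in> I"
      by (rule D(4)[OF D(3) _ diff_plus_le]) (use r that U in simp_all)
    ultimately have "coset I (?x \<oplus> ?y) = coset I (x \<oplus> y)"
      using coset_eq_iff[OF I] U that by simp
    then show ?thesis by (simp add: oplus_def quotient_def r_def)
  qed
  show n: "neg (quotient I) (coset I x) = coset I (\<sim> x)" if "x \<in> U" for x
  proof -
    have "coset I (\<sim> r (coset I x)) = coset I (\<sim> x)"
      using coset_eq_iff[OF I, of "\<sim> r (coset I x)" "\<sim> x"] r[OF that] that by (simp add: diff_neg)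
    then show ?thesis by (simp add: neg_def quotient_def r_def)
  qed
  show z: "zero (quotient I) = coset I \<^bold>0" by (simp add: zero_def quotient_def)
  show "one (quotient I) = coset I \<^bold>1" by (simp add: one_def[of "quotient I"] z n)
qed

lemma mv_algebra_quotient:
  assumes I: "is_ideal I"
  shows "mv_algebra (quotient I)"
proof -
  note q = quotient_simps[OF I]
  have "wf_alg mv_arity (quotient I)"
    by (rule wf_alg_mvI[where U = "coset I ` U"]) (auto simp: q)
  then show ?thesis
    unfolding mv_algebra_def imp_def by (simp add: q assoc luk) (simp add: comm)
qed

lemma coset_hom:
  assumes I: "is_ideal I"
  shows "alg_hom mv_arity (coset I) A (quotient I)"
  unfolding alg_hom_def
proof (intro conjI allI impI)
  note q = quotient_simps[OF I]
  show "coset I ` U \<subseteq> universe (quotient I)" by (simp add: q)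
  fix f xs assume xs: "length xs = mv_arity f \<and> set xs \<subseteq> U"
  show "coset I (interp A f xs) = interp (quotient I) f (map (coset I) xs)"
  proof (cases f)
    case Oplus
    then obtain x y where "xs = [x, y]" using xs by (auto simp: numeral_2_eq_2 length_Suc_conv)
    then show ?thesis using q(2)[of x y] xs Oplus by (simp add: oplus_def)
  next
    case Neg
    then obtain x where "xs = [x]" using xs by (auto simp: length_Suc_conv)
    then show ?thesis using q(3)[of x] xs Neg by (simp add: neg_def)
  next
    case Zero
    then show ?thesis using q(4) xs by (simp add: zero_def)
  qed
qed

end

lemma chain_quotient_separating:
  fixes A :: "(mv_op, 'a) alg"
  assumes A: "mv_algebra A" and x: "x \<in> universe A" "x \<noteq> zero A"
  shows "\<exists>(C :: (mv_op, 'a set) alg) h. mv_algebra C \<and>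
    (\<forall>a\<in>universe C. \<forall>b\<in>universe C. imp C a b = one C \<or> imp C b a = one C) \<and>
    alg_hom mv_arity h A C \<and> h x \<noteq> zero C"
proof -
  interpret mv_alg A by unfold_locales (rule A)
  obtain I where I: "is_ideal I" "x \<notin> I"
    and prime: "\<And>a b. a \<in> U \<Longrightarrow> b \<in> U \<Longrightarrow> a \<ominus> b \<in> I \<or> b \<ominus> a \<in> I"
    using prime_ideal_avoiding[OF x] by blast
  note q = quotient_simps[OF I(1)]
  have imp: "imp (quotient I) (coset I a) (coset I b) = one (quotient I)"
    if "a \<in> U" "b \<in> U" "a \<ominus> b \<in> I" for a b
    using that coset_eq_iff[OF I(1), of "\<sim> a \<oplus> b" "one A"] is_idealD(2)[OF I(1)]
      diff_eq_zero_iff[of "\<sim> a \<oplus> b" "one A"]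
    by (simp add: imp_def q) (simp add: diff_def)
  have "coset I x \<noteq> zero (quotient I)"
    using I(2) x coset_eq_iff[OF I(1), of x "zero A"] by (simp add: q diff_def)
  moreover have "imp (quotient I) X Y = one (quotient I) \<or> imp (quotient I) Y X = one (quotient I)"
    if "X \<in> universe (quotient I)" "Y \<in> universe (quotient I)" for X Y
    using that prime imp unfolding q(1) by blast
  ultimately show ?thesis
    using mv_algebra_quotient[OF I(1)] coset_hom[OF I(1)] by blast
qed

section \<open>Linear inequalities in ordered abelian groups\<close>

text \<open>The midpoint of the largest lower and the smallest upper bound also meets the strict requirements,
since a strict bound on one side is strictly separated from all bounds on the other side.\<close>

lemma between_finite_bounds:
  fixes l :: "'a \<Rightarrow> real" and u :: "'b \<Rightarrow> real"
  assumes fin: "finite A" "finite B"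
    and le: "\<And>a b. a \<in> A \<Longrightarrow> b \<in> B \<Longrightarrow> l a \<le> u b"
    and less: "\<And>a b. a \<in> A \<Longrightarrow> b \<in> B \<Longrightarrow> S a \<or> T b \<Longrightarrow> l a < u b"
  shows "\<exists>z. (\<forall>a\<in>A. l a \<le> z \<and> (S a \<longrightarrow> l a < z)) \<and> (\<forall>b\<in>B. z \<le> u b \<and> (T b \<longrightarrow> z < u b))"
proof -
  consider "A = {}" "B = {}" | "A \<noteq> {}" "B = {}" | "A = {}" "B \<noteq> {}" | "A \<noteq> {}" "B \<noteq> {}" by blast
  then show ?thesis
  proof cases
    case 1 then show ?thesis by simp
  next
    case 2
    have "l a < Max (l ` A) + 1" if "a \<in> A" for a
      by (rule le_less_trans[OF Max_ge[of "l ` A" "l a"]]) (use that fin in auto)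
    then show ?thesis using 2 by (intro exI[of _ "Max (l ` A) + 1"]) (auto intro: less_imp_le)
  next
    case 3
    have "Min (u ` B) - 1 < u b" if "b \<in> B" for b
      by (rule less_le_trans[OF _ Min_le[of "u ` B" "u b"]]) (use that fin in auto)
    then show ?thesis using 3 by (intro exI[of _ "Min (u ` B) - 1"]) (auto intro: less_imp_le)
  next
    case 4
    let ?L = "Max (l ` A)" and ?U = "Min (u ` B)"
    have "?L \<in> l ` A" "?U \<in> u ` B" using 4 fin by (intro Max_in Min_in; simp)+
    then obtain a0 b0 where a0: "a0 \<in> A" "?L = l a0" and b0: "b0 \<in> B" "?U = u b0" by blast
    have L: "l a \<le> ?L" if "a \<in> A" for a using that fin by simp
    have U: "?U \<le> u b" if "b \<in> B" for b using that fin by simp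
    have "?L \<le> ?U" using le[OF a0(1) b0(1)] a0 b0 by simp
    moreover have "l a < ?U" if "a \<in> A" "S a" for a using less[OF that(1) b0(1)] that b0 by simp
    moreover have "?L < u b" if "b \<in> B" "T b" for b using less[OF a0(1) that(1)] that a0 by simp
    ultimately show ?thesis
      using L U by (intro exI[of _ "(?L + ?U) / 2"]) (fastforce simp: field_simps)
  qed
qed

text \<open>The predicates \<open>N\<close> and \<open>P\<close> describe which integer linear forms take a
nonnegative and which a positive value under some evaluation of the variables in an ordered abelian group; the
assumptions are the closure properties of the positive cone of the group. The elements of \<open>C\<close> are
the constraints, those of \<open>D\<close> the strict ones. The induction eliminates one variable
\<open>x\<close> at a time: a form with a positive and one with a negative coefficient at \<open>x\<close> are
combined with positive integer factors so that \<open>x\<close> cancels, and a real value for \<open>x\<close>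
fits between the resulting lower and upper bounds.\<close>

theorem fourier_motzkin:
  fixes N P :: "('i \<Rightarrow> int) \<Rightarrow> bool" and C D :: "('i \<Rightarrow> int) set"
  assumes N_add: "\<And>p q. N p \<Longrightarrow> N q \<Longrightarrow> N (\<lambda>i. p i + q i)"
    and P_add: "\<And>p q. P p \<Longrightarrow> N q \<Longrightarrow> P (\<lambda>i. p i + q i)"
    and P_N: "\<And>p. P p \<Longrightarrow> N p"
    and P_0: "\<not> P (\<lambda>_. 0)"
    and F: "finite F" and C: "finite C" "D \<subseteq> C"
    and supp: "\<And>p i. p \<in> C \<Longrightarrow> i \<notin> F \<Longrightarrow> p i = 0"
    and CN: "\<And>p. p \<in> C \<Longrightarrow> N p" and DP: "\<And>p. p \<in> D \<Longrightarrow> P p"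
  shows "\<exists>y :: 'i \<Rightarrow> real. (\<forall>p\<in>C. 0 \<le> (\<Sum>i\<in>F. p i * y i)) \<and> (\<forall>p\<in>D. 0 < (\<Sum>i\<in>F. p i * y i))"
  using F C supp CN DP
proof (induction F arbitrary: C D rule: finite_induct)
  case empty
  have "D = {}"
  proof (rule ccontr)
    assume "D \<noteq> {}"
    then obtain p where "p \<in> D" by blast
    moreover from this have "p = (\<lambda>_. 0)" using empty by auto
    ultimately show False using empty.prems(5) P_0 by blast
  qed
  then show ?case by simp
next
  case (insert x F)
  have N_mult: "N (\<lambda>i. int (Suc k) * p i)" if "N p" for k p
  proof (induction k)
    case (Suc k)
    from N_add[OF Suc that] show ?case by (simp add: algebra_simps)
  qed (simp add: that)
  have P_mult: "P (\<lambda>i. int (Suc k) * p i)" if "P p" for k p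
  proof (induction k)
    case (Suc k)
    from P_add[OF Suc P_N[OF that]] show ?case by (simp add: algebra_simps)
  qed (simp add: that)
  have pos: "\<exists>k. c = int (Suc k)" if "c > 0" for c using that by (intro exI[of _ "nat (c - 1)"]) simp
  define e where "e p q = (\<lambda>i. p x * q i + (- q x) * p i)" for p q :: "'i \<Rightarrow> int"
  have eN: "N (e p q)" if h: "N p" "N q" "p x > 0" "q x < 0" for p q
  proof -
    obtain j k where "p x = int (Suc j)" "- q x = int (Suc k)" using pos[of "p x"] pos[of "- q x"] h by (metis neg_0_less_iff_less)
    with N_add[OF N_mult[OF that(2), of j] N_mult[OF that(1), of k]] show ?thesis by (simp add: e_def)
  qed
  have eP: "P (e p q)" if h: "N p" "N q" "P p \<or> P q" "p x > 0" "q x < 0" for p q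
  proof -
    obtain j k where jk: "p x = int (Suc j)" "- q x = int (Suc k)" using pos[of "p x"] pos[of "- q x"] h by (metis neg_0_less_iff_less)
    show ?thesis
    proof (cases "P q")
      case True
      from P_add[OF P_mult[OF this, of j] N_mult[OF that(1), of k]] jk show ?thesis by (simp add: e_def)
    next
      case False
      with that have "P p" by simp
      from P_add[OF P_mult[OF this, of k] N_mult[OF that(2), of j]] jk show ?thesis
        by (simp add: e_def add.commute)
    qed
  qed
  define Cp where "Cp = {p \<in> C. p x > 0}"
  define Cn where "Cn = {p \<in> C. p x < 0}"
  \<comment> \<open>The constraints left after eliminating \<open>x\<close>; a combination is strict if one of its parts is.\<close>
  define C' where "C' = {p \<in> C. p x = 0} \<union> (\<lambda>(p, q). e p q) ` (Cp \<times> Cn)"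
  define D' where "D' = {p \<in> D. p x = 0} \<union> (\<lambda>(p, q). e p q) ` {(p, q) \<in> Cp \<times> Cn. p \<in> D \<or> q \<in> D}"
  have finC: "finite Cp" "finite Cn" using insert.prems(1) by (auto simp: Cp_def Cn_def)
  have "\<exists>y :: 'i \<Rightarrow> real. (\<forall>p\<in>C'. 0 \<le> (\<Sum>i\<in>F. p i * y i)) \<and> (\<forall>p\<in>D'. 0 < (\<Sum>i\<in>F. p i * y i))"
  proof (rule insert.IH)
    show "finite C'" using finC insert.prems(1) by (auto simp: C'_def)
    show "D' \<subseteq> C'" using insert.prems(2) by (auto simp: C'_def D'_def)
    show "r i = 0" if r: "r \<in> C'" and i: "i \<notin> F" for r i
    proof -
      from r consider (new) p q where "r = e p q" "p \<in> C" "q \<in> C" | (old) "r \<in> C" "r x = 0"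
        by (auto simp: C'_def Cp_def Cn_def)
      then show ?thesis
      proof cases
        case (new p q)
        show ?thesis
        proof (cases "i = x")
          case False
          then have "p i = 0" "q i = 0" using new i insert.prems(3) by simp_all
          then show ?thesis by (simp add: new e_def)
        qed (simp add: new e_def)
      next
        case old
        then show ?thesis using i insert.prems(3) by (cases "i = x") simp_all
      qed
    qed
    show "N p" if "p \<in> C'" for p
      using that insert.prems(4) eN by (auto simp: C'_def Cp_def Cn_def)
    show "P p" if "p \<in> D'" for p
      using that insert.prems(4,5) eP by (auto simp: D'_def Cp_def Cn_def)
  qed
  then obtain y :: "'i \<Rightarrow> real" where yC: "\<And>p. p \<in> C' \<Longrightarrow> 0 \<le> (\<Sum>i\<in>F. p i * y i)"
    and yD: "\<And>p. p \<in> D' \<Longrightarrow> 0 < (\<Sum>i\<in>F. p i * y i)" by blast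
  define s where "s p = (\<Sum>i\<in>F. p i * y i)" for p :: "'i \<Rightarrow> int"
  have s_e: "s (e p q) = p x * s q - q x * s p" for p q
    by (simp add: s_def e_def sum_distrib_left sum.distrib sum_negf algebra_simps flip: sum_subtractf)
  have "\<exists>z. (\<forall>p\<in>Cp. - s p / p x \<le> z \<and> (p \<in> D \<longrightarrow> - s p / p x < z)) \<and>
      (\<forall>q\<in>Cn. z \<le> - s q / q x \<and> (q \<in> D \<longrightarrow> z < - s q / q x))"
  proof (rule between_finite_bounds[OF finC])
    fix p q assume pq: "p \<in> Cp" "q \<in> Cn"
    then have x: "real_of_int (p x) > 0" "real_of_int (q x) < 0" by (auto simp: Cp_def Cn_def)
    have "e p q \<in> C'" using pq by (auto simp: C'_def)
    from yC[OF this] have "0 \<le> s (e p q)" by (simp add: s_def)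
    with x show "- s p / p x \<le> - s q / q x" by (simp add: s_e field_simps)
    assume "p \<in> D \<or> q \<in> D"
    with pq have "e p q \<in> D'" by (auto simp: D'_def)
    from yD[OF this] have "0 < s (e p q)" by (simp add: s_def)
    with x show "- s p / p x < - s q / q x" by (simp add: s_e field_simps)
  qed
  then obtain z where z: "\<And>p. p \<in> Cp \<Longrightarrow> - s p / p x \<le> z \<and> (p \<in> D \<longrightarrow> - s p / p x < z)"
      "\<And>q. q \<in> Cn \<Longrightarrow> z \<le> - s q / q x \<and> (q \<in> D \<longrightarrow> z < - s q / q x)" by blast
  have sum: "(\<Sum>i\<in>insert x F. p i * (y(x := z)) i) = p x * z + s p" for p :: "'i \<Rightarrow> int"
  proof -
    have "(\<Sum>i\<in>F. p i * (y(x := z)) i) = s p"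
      unfolding s_def by (rule sum.cong) (use insert.hyps in auto)
    then show ?thesis using insert.hyps by simp
  qed
  have main: "0 \<le> p x * z + s p \<and> (p \<in> D \<longrightarrow> 0 < p x * z + s p)" if "p \<in> C" for p
  proof -
    consider "p x > 0" | "p x < 0" | "p x = 0" by linarith
    then show ?thesis
    proof cases
      case 1
      then have "real_of_int (p x) > 0" "p \<in> Cp" using that by (auto simp: Cp_def)
      with z(1)[of p] show ?thesis by (auto simp: field_simps)
    next
      case 2
      then have "real_of_int (p x) < 0" "p \<in> Cn" using that by (auto simp: Cn_def)
      with z(2)[of p] show ?thesis by (auto simp: field_simps)
    next
      case 3
      then have "p \<in> C'" "p \<in> D \<Longrightarrow> p \<in> D'" using that by (auto simp: C'_def D'_def)
      with yC yD 3 show ?thesis by (auto simp: s_def)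
    qed
  qed
  show ?case
    by (rule exI[of _ "y(x := z)"], unfold sum) (use main insert.prems(2) in blast)
qed

text \<open>The set \<open>K\<close> is a positive cone of the group, so an equation
\<open>g a \<otimes> g b = w \<otimes> (g c \<otimes> g d)\<close> with \<open>w\<close> in
\<open>K\<close> says that the sum of the first two elements is at least that of the other two. The existence
of \<open>y\<close> thus means that the finitely many valid inequalities between sums of two generators can be
realised in the reals. If the unit lies in \<open>K\<close>, an equation is the pair of inequalities with
\<open>w = \<one>\<close>. The vectors \<open>v (a, b, c, d)\<close> in the proof are the linear forms
of these inequalities, and \<open>\<phi>\<close> evaluates a linear form in the group.\<close>

theorem ordered_group_real_solution:
  fixes g :: "'i \<Rightarrow> 'g" and G (structure)
  assumes G: "comm_group G"
    and K: "K \<subseteq> carrier G" "\<And>x y. x \<in> K \<Longrightarrow> y \<in> K \<Longrightarrow> x \<otimes> y \<in> K"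
    and pointed: "\<And>x y. x \<in> K \<Longrightarrow> y \<in> K \<Longrightarrow> x \<otimes> y = \<one> \<Longrightarrow> x = \<one>"
    and F: "finite F" and g: "g ` F \<subseteq> carrier G"
  shows "\<exists>y :: 'i \<Rightarrow> real. \<forall>a\<in>F. \<forall>b\<in>F. \<forall>c\<in>F. \<forall>d\<in>F. \<forall>w\<in>K. g a \<otimes> g b = w \<otimes> (g c \<otimes> g d) \<longrightarrow>
      y c + y d \<le> y a + y b \<and> (w \<noteq> \<one> \<longrightarrow> y c + y d < y a + y b)"
proof -
  interpret comm_group G by (rule G)
  have gc: "g i \<in> carrier G" if "i \<in> F" for i using that g by auto
  define \<phi> where "\<phi> p = (\<Otimes>i\<in>F. g i [^] (p i :: int))" for p
  have \<phi>_closed: "\<phi> p \<in> carrier G" for p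
    unfolding \<phi>_def by (rule finprod_closed) (use gc in auto)
  have \<phi>_add: "\<phi> (\<lambda>i. p i + q i) = \<phi> p \<otimes> \<phi> q" for p q
  proof -
    have "\<phi> (\<lambda>i. p i + q i) = (\<Otimes>i\<in>F. g i [^] p i \<otimes> g i [^] q i)"
      unfolding \<phi>_def by (rule finprod_cong') (use gc in \<open>auto simp: int_pow_mult\<close>)
    then show ?thesis unfolding \<phi>_def by (subst (asm) finprod_multf) (use gc in auto)
  qed
  have \<phi>_unit: "\<phi> (\<lambda>i. of_bool (i = a)) = g a" if "a \<in> F" for a
  proof -
    have "\<phi> (\<lambda>i. of_bool (i = a)) = (\<Otimes>i\<in>F. if a = i then g i else \<one>)"
      unfolding \<phi>_def by (rule finprod_cong') (use gc in auto)
    also have "\<dots> = g a" using that F gc by (intro finprod_singleton) auto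
    finally show ?thesis .
  qed
  define v :: "'i \<times> 'i \<times> 'i \<times> 'i \<Rightarrow> 'i \<Rightarrow> int"
    where "v = (\<lambda>(a, b, c, d) i. of_bool (i = a) + of_bool (i = b) - of_bool (i = c) - of_bool (i = d))"
  have \<phi>_v: "\<phi> (v (a, b, c, d)) = w"
    if "a \<in> F" "b \<in> F" "c \<in> F" "d \<in> F" "w \<in> K" "g a \<otimes> g b = w \<otimes> (g c \<otimes> g d)" for a b c d w
  proof -
    have "\<phi> (v (a, b, c, d)) \<otimes> (g c \<otimes> g d) = \<phi> (\<lambda>i. of_bool (i = a) + of_bool (i = b))"
      using that by (simp add: v_def flip: \<phi>_unit \<phi>_add)
    also have "\<dots> = w \<otimes> (g c \<otimes> g d)" using that by (simp add: \<phi>_add \<phi>_unit)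
    finally show ?thesis using that gc \<phi>_closed K(1) by (auto simp: right_cancel)
  qed
  define V where "V = v ` (F \<times> F \<times> F \<times> F)"
  have "\<exists>y :: 'i \<Rightarrow> real. (\<forall>p\<in>{p \<in> V. \<phi> p \<in> K}. 0 \<le> (\<Sum>i\<in>F. p i * y i)) \<and>
      (\<forall>p\<in>{p \<in> V. \<phi> p \<in> K \<and> \<phi> p \<noteq> \<one>}. 0 < (\<Sum>i\<in>F. p i * y i))"
  proof (rule fourier_motzkin[where N = "\<lambda>p. \<phi> p \<in> K" and P = "\<lambda>p. \<phi> p \<in> K \<and> \<phi> p \<noteq> \<one>"])
    show "finite F" "finite {p \<in> V. \<phi> p \<in> K}" using F by (auto simp: V_def)
    show "\<not> (\<phi> (\<lambda>_. 0) \<in> K \<and> \<phi> (\<lambda>_. 0) \<noteq> \<one>)" by (simp add: \<phi>_def)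
    show "\<phi> (\<lambda>i. p i + q i) \<in> K" if "\<phi> p \<in> K" "\<phi> q \<in> K" for p q
      using that by (simp add: \<phi>_add K(2))
    show "\<phi> (\<lambda>i. p i + q i) \<in> K \<and> \<phi> (\<lambda>i. p i + q i) \<noteq> \<one>"
      if "\<phi> p \<in> K \<and> \<phi> p \<noteq> \<one>" "\<phi> q \<in> K" for p q
      using that K(2) pointed by (metis \<phi>_add)
    show "p i = 0" if "p \<in> {p \<in> V. \<phi> p \<in> K}" "i \<notin> F" for p i
      using that by (auto simp: V_def v_def)
  qed auto
  then obtain y :: "'i \<Rightarrow> real"
    where y: "\<And>p. p \<in> V \<Longrightarrow> \<phi> p \<in> K \<Longrightarrow> 0 \<le> (\<Sum>i\<in>F. p i * y i)"
      "\<And>p. p \<in> V \<Longrightarrow> \<phi> p \<in> K \<Longrightarrow> \<phi> p \<noteq> \<one> \<Longrightarrow> 0 < (\<Sum>i\<in>F. p i * y i)" by blast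
  have sum_unit: "(\<Sum>i\<in>F. of_bool (i = a) * y i) = y a" if "a \<in> F" for a
    using that F by (simp add: of_bool_def if_distrib[of "\<lambda>x. x * _"] sum.delta cong: if_cong)
  have sum_v: "(\<Sum>i\<in>F. v (a, b, c, d) i * y i) = y a + y b - y c - y d"
    if "a \<in> F" "b \<in> F" "c \<in> F" "d \<in> F" for a b c d
    using that by (simp add: v_def ring_distribs sum.distrib sum_subtractf sum_unit)
  show ?thesis
  proof (intro exI[of _ y] ballI impI)
    fix a b c d w assume h: "a \<in> F" "b \<in> F" "c \<in> F" "d \<in> F" "w \<in> K" "g a \<otimes> g b = w \<otimes> (g c \<otimes> g d)"
    then have "v (a, b, c, d) \<in> V" by (auto simp: V_def)
    with y[of "v (a, b, c, d)"] h show "y c + y d \<le> y a + y b \<and> (w \<noteq> \<one> \<longrightarrow> y c + y d < y a + y b)"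
      by (auto simp: \<phi>_v[OF h] sum_v)
  qed
qed

section \<open>The group of an MV-chain\<close>

context mv_alg begin
text \<open>The truncated product \<open>max 0 (x + y - 1)\<close> of \<open>[0,1]\<close>: what a carry
leaves behind.\<close>

definition times (infixl "\<odot>" 70) where "x \<odot> y = \<sim> (\<sim> x \<oplus> \<sim> y)"

lemma times_closed [simp]: "x \<in> U \<Longrightarrow> y \<in> U \<Longrightarrow> x \<odot> y \<in> U" by (simp add: times_def)

lemma times_comm: "x \<in> U \<Longrightarrow> y \<in> U \<Longrightarrow> x \<odot> y = y \<odot> x" by (simp add: times_def comm)

lemma times_assoc: "x \<in> U \<Longrightarrow> y \<in> U \<Longrightarrow> z \<in> U \<Longrightarrow> x \<odot> y \<odot> z = x \<odot> (y \<odot> z)"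
  by (simp add: times_def assoc)

lemma times_zero [simp]: "x \<in> U \<Longrightarrow> x \<odot> \<^bold>0 = \<^bold>0" "x \<in> U \<Longrightarrow> x \<odot> \<sim> x = \<^bold>0"
  by (simp_all add: times_def)

lemma times_eq_diff: "x \<in> U \<Longrightarrow> y \<in> U \<Longrightarrow> x \<odot> y = y \<ominus> \<sim> x"
  by (simp add: times_def diff_def comm)

lemma times_eq_zero_iff: "x \<in> U \<Longrightarrow> y \<in> U \<Longrightarrow> x \<odot> y = \<^bold>0 \<longleftrightarrow> x \<preceq> \<sim> y"
  unfolding times_def le_def by (metis closed(1,2) neg_neg neg_one neg_zero)

lemma plus_eq_one_iff: "x \<in> U \<Longrightarrow> y \<in> U \<Longrightarrow> x \<oplus> y = \<^bold>1 \<longleftrightarrow> \<sim> x \<preceq> y"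
  by (simp add: le_def)

lemma times_eq_oneD: "x \<in> U \<Longrightarrow> y \<in> U \<Longrightarrow> x \<odot> y = \<^bold>1 \<Longrightarrow> y = \<^bold>1"
  using diff_le[of y "\<sim> x"] le_antisym[of y "one A"] by (simp add: times_eq_diff)

text \<open>The three \<open>shift\<close> lemmas are the cases of associativity for addition with carry. Here
no carry occurs in \<open>a + b\<close> and \<open>b + c\<close>; both sides are the excess of
\<open>a + b + c\<close> over 1. The complement of \<open>a\<close> is that of
\<open>a \<oplus> b\<close> plus \<open>b\<close>, and similarly for \<open>c\<close>, so both complements
are the same sum.\<close>

lemma shift_low:
  assumes "a \<in> U" "b \<in> U" "c \<in> U" "a \<odot> b = \<^bold>0" "b \<odot> c = \<^bold>0"
  shows "(a \<oplus> b) \<odot> c = a \<odot> (b \<oplus> c)"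
proof -
  have "b \<preceq> \<sim> a" "b \<preceq> \<sim> c" using assms by (simp_all add: times_eq_zero_iff times_comm[of a])
  then have a: "\<sim> (a \<oplus> b) \<oplus> b = \<sim> a" and c: "\<sim> (b \<oplus> c) \<oplus> b = \<sim> c"
    using le_diff_plus[of b "\<sim> a"] le_diff_plus[of b "\<sim> c"] assms by (simp_all add: diff_def comm[of b c])
  have "\<sim> (a \<oplus> b) \<oplus> \<sim> c = \<sim> a \<oplus> \<sim> (b \<oplus> c)"
    using assms by (simp add: a[symmetric] c[symmetric] del: neg_neg) (simp add: ac)
  then show ?thesis using assms by (simp add: times_def)
qed

text \<open>A carry occurs in both sums: the dual of \<open>shift_low\<close>.\<close>

lemma shift_high:
  assumes "a \<in> U" "b \<in> U" "c \<in> U" "a \<oplus> b = \<^bold>1" "b \<oplus> c = \<^bold>1"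
  shows "(a \<odot> b) \<oplus> c = a \<oplus> (b \<odot> c)"
  using shift_low[of "\<sim> a" "\<sim> b" "\<sim> c"] assms by (auto simp: times_def intro: neg_inj)

text \<open>A carry occurs in \<open>a + b\<close> only. With \<open>d\<close> the fraction left by it,
\<open>b\<close> is \<open>d\<close> plus the complement of \<open>a\<close>. Since \<open>b\<close> can be
added to \<open>c\<close> without truncation, so can its two parts, and that complement can be subtracted
again.\<close>

lemma shift_mixed:
  assumes U: "a \<in> U" "b \<in> U" "c \<in> U" and "a \<oplus> b = \<^bold>1" "b \<odot> c = \<^bold>0"
  shows "(a \<odot> b) \<oplus> c = a \<odot> (b \<oplus> c)"
proof -
  define d where "d = a \<odot> b"
  have d: "d \<in> U" "d = b \<ominus> \<sim> a" using U by (simp_all add: d_def times_eq_diff)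
  have b: "d \<oplus> \<sim> a = b" using assms by (simp add: d(2) le_diff_plus plus_eq_one_iff)
  have "d \<preceq> \<sim> c"
    using diff_le[of b "\<sim> a"] le_trans[of d b "\<sim> c"] d assms by (simp add: times_eq_zero_iff)
  moreover have "\<sim> a \<odot> d = \<^bold>0"
    using diff_le_neg[of b "\<sim> a"] d U times_eq_zero_iff[of d "\<sim> a"] by (simp add: times_comm)
  ultimately have "(\<sim> a \<oplus> d) \<odot> c = \<sim> a \<odot> (d \<oplus> c)"
    using d U by (intro shift_low) (simp_all add: times_eq_zero_iff)
  then have "\<sim> a \<odot> (d \<oplus> c) = \<^bold>0" using b d(1) assms by (simp add: comm[of "\<sim> a"])
  then have "d \<oplus> c \<preceq> \<sim> (\<sim> a)"
    using d(1) U times_eq_zero_iff[of "d \<oplus> c" "\<sim> a"] by (simp add: times_comm)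
  then have "(d \<oplus> c) \<oplus> \<sim> a \<ominus> \<sim> a = d \<oplus> c" using d(1) U by (intro plus_diff_cancel) simp_all
  moreover have "(d \<oplus> c) \<oplus> \<sim> a = b \<oplus> c" using d(1) U by (simp add: b[symmetric] ac del: closed(5))
  ultimately show ?thesis using U by (simp add: times_eq_diff[of a "b \<oplus> c"] flip: d_def)
qed

end

locale mv_chain = mv_alg +
  assumes linear: "x \<in> U \<Longrightarrow> y \<in> U \<Longrightarrow> x \<preceq> y \<or> y \<preceq> x"
    and nontrivial: "\<^bold>0 \<noteq> \<^bold>1"
begin

text \<open>In a chain the sum of two elements either reaches 1 or leaves no excess; addition with carry is
exact for this reason.\<close>

lemma plus_or_times: "x \<in> U \<Longrightarrow> y \<in> U \<Longrightarrow> x \<oplus> y \<noteq> \<^bold>1 \<Longrightarrow> x \<odot> y = \<^bold>0"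
  using linear[of "\<sim> x" y] neg_le[of "\<sim> x" y] linear
  by (metis closed(2) plus_eq_one_iff times_comm times_eq_zero_iff)

text \<open>Elements of the group are pairs of an integer and a fraction different from 1. The positive cone
consists of the pairs with nonnegative integer part.\<close>

definition carry_add :: "int \<times> 'a \<Rightarrow> int \<times> 'a \<Rightarrow> int \<times> 'a" where
  "carry_add p q = (if snd p \<oplus> snd q = \<^bold>1 then (fst p + fst q + 1, snd p \<odot> snd q)
              else (fst p + fst q, snd p \<oplus> snd q))"

definition chain_group :: "(int \<times> 'a) monoid" where
  "chain_group = \<lparr>carrier = UNIV \<times> (U - {\<^bold>1}), mult = carry_add, one = (0, \<^bold>0)\<rparr>"

lemma carry_add_assoc:
  assumes "a \<in> U" "b \<in> U" "c \<in> U" "a \<noteq> \<^bold>1" "b \<noteq> \<^bold>1" "c \<noteq> \<^bold>1"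
  shows "carry_add (carry_add (i, a) (j, b)) (k, c) = carry_add (i, a) (carry_add (j, b) (k, c))"
proof (cases "a \<oplus> b = \<^bold>1"; cases "b \<oplus> c = \<^bold>1")
  assume h: "a \<oplus> b = \<^bold>1" "b \<oplus> c = \<^bold>1"
  then show ?thesis using shift_high[of a b c] assms by (simp add: carry_add_def times_assoc)
next
  assume h: "a \<oplus> b = \<^bold>1" "b \<oplus> c \<noteq> \<^bold>1"
  then have eq: "(a \<odot> b) \<oplus> c = a \<odot> (b \<oplus> c)"
    using shift_mixed[of a b c] plus_or_times[of b c] assms by simp
  then have "(a \<odot> b) \<oplus> c \<noteq> \<^bold>1" using h times_eq_oneD[of a "b \<oplus> c"] assms by auto
  moreover have "a \<oplus> (b \<oplus> c) = \<^bold>1" using h assms by (simp flip: assoc)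
  ultimately show ?thesis using h eq by (simp add: carry_add_def)
next
  assume h: "a \<oplus> b \<noteq> \<^bold>1" "b \<oplus> c = \<^bold>1"
  then have eq: "a \<oplus> (b \<odot> c) = (a \<oplus> b) \<odot> c"
    using shift_mixed[of c b a] plus_or_times[of a b] assms by (simp add: comm times_comm)
  then have "a \<oplus> (b \<odot> c) \<noteq> \<^bold>1"
    using h times_eq_oneD[of c "a \<oplus> b"] assms by (auto simp: times_comm)
  moreover have "a \<oplus> b \<oplus> c = \<^bold>1" using h assms by (simp add: assoc)
  ultimately show ?thesis using h eq by (simp add: carry_add_def)
next
  assume h: "a \<oplus> b \<noteq> \<^bold>1" "b \<oplus> c \<noteq> \<^bold>1"
  then show ?thesis
    using shift_low[of a b c] plus_or_times[of a b] plus_or_times[of b c] assms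
    by (simp add: carry_add_def assoc)
qed

lemma chain_group_simps [simp]: "carrier chain_group = UNIV \<times> (U - {\<^bold>1})" "mult chain_group = carry_add" "monoid.one chain_group = (0, \<^bold>0)"
  by (simp_all add: chain_group_def)

lemma comm_group_chain_group: "comm_group chain_group"
proof (rule comm_groupI)
  show "\<one>\<^bsub>chain_group\<^esub> \<in> carrier chain_group" using nontrivial by simp
  fix x y z assume x: "x \<in> carrier chain_group"
  then show "\<one>\<^bsub>chain_group\<^esub> \<otimes>\<^bsub>chain_group\<^esub> x = x" by (auto simp: carry_add_def)
  show "\<exists>y\<in>carrier chain_group. y \<otimes>\<^bsub>chain_group\<^esub> x = \<one>\<^bsub>chain_group\<^esub>"
  proof (cases "snd x = \<^bold>0")
    case True
    then show ?thesis using nontrivial by (intro bexI[of _ "(- fst x, \<^bold>0)"]) (auto simp: carry_add_def)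
  next
    case False
    have "\<sim> (snd x) \<noteq> \<^bold>1" using False x neg_inj[of "snd x" "zero A"] by auto
    then show ?thesis using x
      by (intro bexI[of _ "(- fst x - 1, \<sim> (snd x))"]) (auto simp: carry_add_def times_comm[of "\<sim> _"])
  qed
  assume y: "y \<in> carrier chain_group"
  show "x \<otimes>\<^bsub>chain_group\<^esub> y = y \<otimes>\<^bsub>chain_group\<^esub> x" using x y by (auto simp: carry_add_def comm times_comm)
  show "x \<otimes>\<^bsub>chain_group\<^esub> y \<in> carrier chain_group" using x y times_eq_oneD[of "snd x" "snd y"] by (auto simp: carry_add_def)
  assume z: "z \<in> carrier chain_group"
  show "x \<otimes>\<^bsub>chain_group\<^esub> y \<otimes>\<^bsub>chain_group\<^esub> z = x \<otimes>\<^bsub>chain_group\<^esub> (y \<otimes>\<^bsub>chain_group\<^esub> z)"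
    using x y z carry_add_assoc[of "snd x" "snd y" "snd z" "fst x" "fst y" "fst z"] by (auto simp: mem_Times_iff)
qed

text \<open>The fraction 1 does not occur in the group, so the top element becomes the integer 1.\<close>

definition embed :: "'a \<Rightarrow> int \<times> 'a" where
  "embed a = (if a = \<^bold>1 then (1, \<^bold>0) else (0, a))"

text \<open>The order and the partial sums of the group of the chain, restricted to finitely many elements,
are realised by reals. Closure of \<open>F\<close> under negation makes the upper bound 1 a consequence of the
lower bound 0.\<close>

theorem finite_partial_embedding:
  assumes F: "finite F" "F \<subseteq> U" "\<^bold>0 \<in> F" and negF: "\<And>a. a \<in> F \<Longrightarrow> \<sim> a \<in> F"
  shows "\<exists>y :: 'a \<Rightarrow> real. y \<^bold>0 = 0 \<and> (\<forall>a\<in>F. 0 \<le> y a \<and> y a \<le> 1 \<and> y (\<sim> a) = 1 - y a \<and>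
    (a \<noteq> \<^bold>0 \<longrightarrow> 0 < y a) \<and> (\<forall>b\<in>F. a \<oplus> b \<in> F \<longrightarrow> y (a \<oplus> b) = min (y a + y b) 1))"
proof -
  define K where "K = {p \<in> carrier chain_group. 0 \<le> fst p}"
  have "\<exists>y :: 'a \<Rightarrow> real. \<forall>a\<in>F. \<forall>b\<in>F. \<forall>c\<in>F. \<forall>d\<in>F. \<forall>w\<in>K.
      embed a \<otimes>\<^bsub>chain_group\<^esub> embed b = w \<otimes>\<^bsub>chain_group\<^esub> (embed c \<otimes>\<^bsub>chain_group\<^esub> embed d) \<longrightarrow>
      y c + y d \<le> y a + y b \<and> (w \<noteq> \<one>\<^bsub>chain_group\<^esub> \<longrightarrow> y c + y d < y a + y b)"
  proof (rule ordered_group_real_solution[OF comm_group_chain_group _ _ _ F(1)])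
    show "K \<subseteq> carrier chain_group" by (auto simp: K_def)
    show "x \<otimes>\<^bsub>chain_group\<^esub> y \<in> K" if "x \<in> K" "y \<in> K" for x y
      using that times_eq_oneD[of "snd x" "snd y"] by (auto simp: K_def carry_add_def)
    show "x = \<one>\<^bsub>chain_group\<^esub>" if "x \<in> K" "y \<in> K" "x \<otimes>\<^bsub>chain_group\<^esub> y = \<one>\<^bsub>chain_group\<^esub>" for x y
      using that le_plus[of "snd x" "snd y"] le_zero[of "snd x"]
      by (auto simp: K_def carry_add_def prod_eq_iff split: if_splits)
    show "embed ` F \<subseteq> carrier chain_group" using F(2) nontrivial by (auto simp: embed_def)
  qed
  then obtain y :: "'a \<Rightarrow> real" where
    y: "a \<in> F \<Longrightarrow> b \<in> F \<Longrightarrow> c \<in> F \<Longrightarrow> d \<in> F \<Longrightarrow> w \<in> K \<Longrightarrow>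
      carry_add (embed a) (embed b) = carry_add w (carry_add (embed c) (embed d)) \<Longrightarrow>
      y c + y d \<le> y a + y b \<and> (w \<noteq> (0, \<^bold>0) \<longrightarrow> y c + y d < y a + y b)" for a b c d w
    unfolding chain_group_simps by blast
  have oneF: "\<^bold>1 \<in> F" using negF[OF F(3)] by simp
  have K0: "(0, \<^bold>0) \<in> K" using nontrivial by (simp add: K_def)
  have add0: "carry_add (0, \<^bold>0) p = p" "carry_add p (0, \<^bold>0) = p" if "snd p \<in> U" "snd p \<noteq> \<^bold>1" for p
    using that by (cases p; simp add: carry_add_def)+
  have emb0: "carry_add (0, \<^bold>0) (embed a) = embed a" "carry_add (embed a) (0, \<^bold>0) = embed a" if "a \<in> F" for a
    using that F(2) nontrivial by (auto intro!: add0 simp: embed_def)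
  have e0: "embed \<^bold>0 = (0, \<^bold>0)" "carry_add (0, \<^bold>0) (0, \<^bold>0) = (0, \<^bold>0)"
    using nontrivial by (simp_all add: embed_def carry_add_def)
  \<comment> \<open>All inequalities compare sums of two terms, so increasing affine maps preserve solutions.
  Subtracting \<open>y \<^bold>0\<close> makes it additive; dividing by the value at \<open>\<^bold>1\<close> normalises it.\<close>
  define z where "z a = y a - y \<^bold>0" for a
  have z_eq: "z c = z a + z b" if "a \<in> F" "b \<in> F" "c \<in> F" "carry_add (embed a) (embed b) = embed c" for a b c
    using y[of a b c "zero A" "(0, \<^bold>0)"] y[of c "zero A" a b "(0, \<^bold>0)"] that F(3) K0
    by (simp add: e0 emb0 z_def)
  have z0: "z \<^bold>0 = 0" by (simp add: z_def)
  have z_nonneg: "0 \<le> z a \<and> (a \<noteq> \<^bold>0 \<longrightarrow> 0 < z a)" if "a \<in> F" for a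
  proof -
    have "embed a \<in> K" using that F(2) nontrivial by (auto simp: K_def embed_def)
    moreover have "embed a \<noteq> (0, \<^bold>0)" if "a \<noteq> \<^bold>0" using that by (simp add: embed_def)
    ultimately show ?thesis
      using y[of a "zero A" "zero A" "zero A" "embed a"] that F(3) by (auto simp: e0 emb0 z_def)
  qed
  have z1: "0 < z \<^bold>1" using z_nonneg[OF oneF] nontrivial by auto
  have z_neg: "z (\<sim> a) = z \<^bold>1 - z a" if "a \<in> F" for a
  proof -
    have a: "a \<in> U" using that F(2) by auto
    have "\<sim> a = \<^bold>1 \<longleftrightarrow> a = \<^bold>0" using a neg_inj[of a "zero A"] by auto
    then have "carry_add (embed a) (embed (\<sim> a)) = embed \<^bold>1"
      using a nontrivial by (auto simp: embed_def carry_add_def)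
    then have "z \<^bold>1 = z a + z (\<sim> a)" using that negF oneF by (intro z_eq) auto
    then show ?thesis by simp
  qed
  have z_le: "z a \<le> z \<^bold>1" if "a \<in> F" for a
    using z_neg[OF that] z_nonneg[OF negF[OF that]] by linarith
  have z_plus: "z (a \<oplus> b) = min (z a + z b) (z \<^bold>1)" if ab: "a \<in> F" "b \<in> F" "a \<oplus> b \<in> F" for a b
  proof -
    have U: "a \<in> U" "b \<in> U" using ab F(2) by auto
    show ?thesis
    proof (cases "a \<oplus> b = \<^bold>1")
      case False
      then have "a \<noteq> \<^bold>1" "b \<noteq> \<^bold>1" using U by auto
      then have "carry_add (embed a) (embed b) = embed (a \<oplus> b)"
        using False by (simp add: embed_def carry_add_def)
      then have "z (a \<oplus> b) = z a + z b" using ab by (intro z_eq)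
      then show ?thesis using z_le[OF ab(3)] by simp
    next
      case True
      \<comment> \<open>The excess of \<open>a + b\<close> over \<open>\<^bold>1\<close>; the first two cases arise as \<open>embed\<close> treats \<open>\<^bold>1\<close> separately.\<close>
      define w where "w = (if a = \<^bold>1 then embed b else if b = \<^bold>1 then embed a else (0, a \<odot> b))"
      have "w \<in> K"
        using U nontrivial times_eq_oneD[of a b] by (auto simp: w_def K_def embed_def)
      moreover have "carry_add (embed a) (embed b) = carry_add w (embed \<^bold>1)"
        using U True nontrivial times_eq_oneD[of a b]
        by (auto simp: w_def embed_def carry_add_def)
      ultimately have "z \<^bold>1 \<le> z a + z b"
        using y[of a b "one A" "zero A" w] ab F(3) oneF by (simp add: e0 emb0 z_def)
      then show ?thesis by (simp add: True)
    qed
  qed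
  show ?thesis
    using z0 z1 z_nonneg z_le z_neg z_plus
    by (intro exI[of _ "\<lambda>a. z a / z \<^bold>1"]) (auto simp: min_def field_simps)
qed

end

section \<open>Completeness of the unit interval\<close>

fun subtrms :: "('f, 'v) trm \<Rightarrow> ('f, 'v) trm set" where
  "subtrms (Var x) = {Var x}"
| "subtrms (Op f ts) = insert (Op f ts) (\<Union>t\<in>set ts. subtrms t)"

lemma finite_subtrms: "finite (subtrms t)"
  by (induction t) auto

lemma self_in_subtrms: "t \<in> subtrms t"
  by (cases t) auto

context mv_chain begin

text \<open>The value of \<open>t\<close> only depends on the values of its subterms, to which a finite
partial embedding into \<open>[0,1]\<close> applies; it commutes with the operations performed in evaluating
\<open>t\<close>.\<close>

lemma real_valuation:
  assumes t: "wf_trm mv_arity t" and v: "range v \<subseteq> U" and pos: "trm_value A v t \<noteq> \<^bold>0"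
  shows "\<exists>w. range w \<subseteq> universe unit_interval_mv \<and> 0 < trm_value unit_interval_mv w t"
proof -
  define E where "E = insert \<^bold>0 (trm_value A v ` subtrms t)"
  define F where "F = E \<union> neg A ` E"
  have sub_wf: "wf_trm mv_arity s" if "s \<in> subtrms t" for s
    using t that by (induction t) auto
  have "E \<subseteq> U"
    using sub_wf v by (auto simp: E_def intro!: trm_value_in[OF mv_algebra_wf[OF mv]])
  then have F: "finite F" "F \<subseteq> U" "\<^bold>0 \<in> F" "\<And>a. a \<in> F \<Longrightarrow> \<sim> a \<in> F"
    by (auto simp: F_def E_def finite_subtrms subset_iff)
  obtain y :: "'a \<Rightarrow> real" where y0: "y \<^bold>0 = 0"
    and y: "\<And>a. a \<in> F \<Longrightarrow> 0 \<le> y a \<and> y a \<le> 1 \<and> y (\<sim> a) = 1 - y a \<and> (a \<noteq> \<^bold>0 \<longrightarrow> 0 < y a)"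
    and y_plus: "\<And>a b. a \<in> F \<Longrightarrow> b \<in> F \<Longrightarrow> a \<oplus> b \<in> F \<Longrightarrow> y (a \<oplus> b) = min (y a + y b) 1"
    using finite_partial_embedding[OF F] by blast
  \<comment> \<open>Variables that do not occur in \<open>t\<close> may have values outside \<open>F\<close>; they are sent to 0.\<close>
  define w where "w n = (if v n \<in> F then y (v n) else 0)" for n
  have w: "range w \<subseteq> universe unit_interval_mv"
    using y by (auto simp: w_def unit_interval_mv_def)
  have value_F: "trm_value A v s \<in> F" if "s \<in> subtrms t" for s
    using that by (simp add: F_def E_def)
  have val: "trm_value unit_interval_mv w s = y (trm_value A v s)"
    if "subtrms s \<subseteq> subtrms t" for s
    using that
  proof (induction s)
    case (Var n)
    then show ?case using value_F[of "Var n"] by (simp add: w_def)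
  next
    case (Op f ts)
    have sF: "trm_value A v (Op f ts) \<in> F" using Op.prems by (intro value_F) simp
    have IH: "trm_value unit_interval_mv w r = y (trm_value A v r)" "trm_value A v r \<in> F"
      if "r \<in> set ts" for r
      using that Op self_in_subtrms[of r] by (auto intro!: value_F Op.IH)
    have wf: "length ts = mv_arity f" using sub_wf[of "Op f ts"] Op.prems by simp
    show ?case
    proof (cases f)
      case Oplus
      then obtain r s where ts: "ts = [r, s]" using wf by (auto simp: numeral_2_eq_2 length_Suc_conv)
      show ?thesis
        using IH[of r] IH[of s] y_plus[of "trm_value A v r" "trm_value A v s"] sF
        by (simp add: ts Oplus oplus_def unit_interval_mv_def mk_mv_def)
    next
      case Neg
      then obtain r where ts: "ts = [r]" using wf by (auto simp: length_Suc_conv)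
      show ?thesis
        using IH[of r] y[of "trm_value A v r"]
        by (simp add: ts Neg neg_def unit_interval_mv_def mk_mv_def)
    next
      case Zero
      then show ?thesis using wf y0 by (simp add: zero_def unit_interval_mv_def mk_mv_def)
    qed
  qed
  have "0 < y (trm_value A v t)" using y[OF value_F[OF self_in_subtrms]] pos by simp
  then have "0 < trm_value unit_interval_mv w t" using val[of t] by simp
  with w show ?thesis by blast
qed

end

text \<open>It suffices to derive an inequality, since the order is antisymmetric. If
\<open>p \<le> q\<close> fails in \<open>M\<close>, the difference of the two terms has a nonzero value,
which survives in some chain and from there yields a positive real value, although \<open>p\<close> and
\<open>q\<close> agree on \<open>[0,1]\<close>.\<close>

theorem unit_interval_complete:
  fixes M :: "(mv_op, 'a) alg"
  assumes M: "mv_algebra M" and st: "wf_trm mv_arity s" "wf_trm mv_arity t"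
    and h: "holds unit_interval_mv s t"
  shows "holds M s t"
  unfolding holds_def
proof (intro allI impI)
  interpret M: mv_alg M by unfold_locales (rule M)
  fix v :: "nat \<Rightarrow> 'a" assume v: "range v \<subseteq> universe M"
  have le: "M.le (trm_value M v p) (trm_value M v q)"
    if pq: "wf_trm mv_arity p" "wf_trm mv_arity q" "holds unit_interval_mv p q" for p q
  proof (rule ccontr)
    assume nle: "\<not> M.le (trm_value M v p) (trm_value M v q)"
    define r :: "(mv_op, nat) trm" where "r = negT (oplusT (negT p) q)"
    have U: "trm_value M v p \<in> universe M" "trm_value M v q \<in> universe M"
      using pq v by (auto intro!: trm_value_in[OF mv_algebra_wf[OF M]])
    have rv: "trm_value M v r = M.diff (trm_value M v p) (trm_value M v q)"
      by (simp add: r_def M.diff_def oplus_def neg_def)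
    then have "trm_value M v r \<in> universe M" "trm_value M v r \<noteq> zero M"
      using nle U M.diff_eq_zero_iff by auto
    then obtain C :: "(mv_op, 'a set) alg" and f where C: "mv_algebra C"
      and lin: "\<And>a b. a \<in> universe C \<Longrightarrow> b \<in> universe C \<Longrightarrow> imp C a b = one C \<or> imp C b a = one C"
      and f: "alg_hom mv_arity f M C" "f (trm_value M v r) \<noteq> zero C"
      using chain_quotient_separating[OF M] by metis
    interpret C: mv_alg C by unfold_locales (rule C)
    have wf: "wf_trm mv_arity r" using pq by (simp add: r_def)
    have fv: "f (trm_value M v r) = trm_value C (f \<circ> v) r"
      by (rule trm_value_hom[OF f(1) mv_algebra_wf[OF M] wf]) (use v in auto)
    have range: "range (f \<circ> v) \<subseteq> universe C" using f(1) v by (auto simp: alg_hom_def)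
    have "trm_value C (f \<circ> v) r \<in> universe C"
      by (rule trm_value_in[OF mv_algebra_wf[OF C] wf]) (use range in auto)
    then have "zero C \<noteq> one C"
      using f(2) fv C.le_one C.le_zero by metis
    then interpret C: mv_chain C
      by unfold_locales (use lin in \<open>auto simp: C.le_def imp_def\<close>)
    obtain w where w: "range w \<subseteq> universe unit_interval_mv" "0 < trm_value unit_interval_mv w r"
      using C.real_valuation[OF wf range] f(2) fv by auto
    then have "trm_value unit_interval_mv w p = trm_value unit_interval_mv w q"
      using pq(3) by (simp add: holds_def)
    then have "trm_value unit_interval_mv w r \<le> 0"
      by (simp add: r_def unit_interval_mv_def mk_mv_def)
    with w(2) show False by simp
  qed
  show "trm_value M v s = trm_value M v t"
  proof (rule M.le_antisym)
    show "M.le (trm_value M v s) (trm_value M v t)" using st h by (intro le)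
    show "M.le (trm_value M v t) (trm_value M v s)" using st h by (intro le) (auto simp: holds_def)
  qed (use st v in \<open>auto intro!: trm_value_in[OF mv_algebra_wf[OF M]]\<close>)
qed

corollary V_MV_unit_interval: "V_MV unit_interval_mv = {M. mv_algebra M}"
  using variety_gen_singleton_iff[OF mv_algebra_wf[OF mv_algebra_unit_interval]]
    mv_algebra_in_variety[OF mv_algebra_unit_interval] mv_algebra_wf unit_interval_complete
  by blast

section \<open>Generators of varieties of SMMV-algebras\<close>

lemma smmv_class_all: "smmv_class {M. mv_algebra M} = {S. smmv_algebra S}"
  by (auto simp: smmv_class_def smmv_algebra_def)

theorem theorem5p4:
  shows "(\<forall>A :: (mv_op, 'a) alg. mv_algebra A \<longrightarrow>
            (V_SMMV (diag_smmv A) :: (smmv_op, 'u) alg set) = smmv_class (V_MV A))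
       \<and> (\<forall>(A :: (mv_op, 'a) alg) (B :: (mv_op, 'b) alg). mv_algebra A \<and> mv_algebra B \<longrightarrow>
            ((V_SMMV (diag_smmv A) :: (smmv_op, 'u) alg set) = V_SMMV (diag_smmv B)
             \<longleftrightarrow> (V_MV A :: (mv_op, 'u) alg set) = V_MV B))
       \<and> (V_SMMV (diag_smmv unit_interval_mv) :: (smmv_op, 'u) alg set) = {S. smmv_algebra S}
       \<and> (\<forall>A :: (mv_op, 'a) alg. mv_algebra A \<and>
              (V_MV A :: (mv_op, 'u) alg set) = {M. mv_algebra M} \<longrightarrow>
            (V_SMMV (diag_smmv A) :: (smmv_op, 'u) alg set) = {S. smmv_algebra S})
       \<and> (V_SMMV (diag_smmv chang_mv) :: (smmv_op, 'u) alg set) = smmv_class (V_MV chang_mv)"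
proof (intro conjI allI impI)
  show "V_SMMV (diag_smmv A) = smmv_class (V_MV A)" if "mv_algebra A" for A :: "(mv_op, 'a) alg"
    using that by (rule V_diag_smmv)
  show "(V_SMMV (diag_smmv A) :: (smmv_op, 'u) alg set) = V_SMMV (diag_smmv B)
      \<longleftrightarrow> (V_MV A :: (mv_op, 'u) alg set) = V_MV B"
    if "mv_algebra A \<and> mv_algebra B" for A :: "(mv_op, 'a) alg" and B :: "(mv_op, 'b) alg"
    using that by (intro V_diag_smmv_eq_iff) auto
  show "V_SMMV (diag_smmv unit_interval_mv) = {S. smmv_algebra S}"
    by (simp add: V_diag_smmv mv_algebra_unit_interval V_MV_unit_interval smmv_class_all)
  show "(V_SMMV (diag_smmv A) :: (smmv_op, 'u) alg set) = {S. smmv_algebra S}"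
    if "mv_algebra A \<and> (V_MV A :: (mv_op, 'u) alg set) = {M. mv_algebra M}"
    for A :: "(mv_op, 'a) alg"
    using that by (simp add: V_diag_smmv smmv_class_all)
  show "V_SMMV (diag_smmv chang_mv) = smmv_class (V_MV chang_mv)"
    by (rule V_diag_smmv[OF mv_algebra_chang])
qed

end
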